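(* Let $k\in\mathbb N$, let $\boldsymbol\alpha=(\alpha_{ij\ell})\in\mathbb R^{k\times k\times k}$ be symmetric under permutations of its indices and $\mathbf h=(h_{ij})\in\mathbb R^{k\times k}$ be symmetric. Assume that $0\le\|\boldsymbol\alpha\|_\infty<2$, where $\|\boldsymbol\alpha\|_\infty=\max_{i,j,\ell\in[k]}|\alpha_{ij\ell}|$. Then the variational problem $$\sup_{\widetilde g\in\widetilde{\mathcal W}^{(k)}_{\mathcal B}}\Bigl\{U^{(\mathcal B)}_{\boldsymbol\alpha,\mathbf h}(\widetilde g)-\tfrac12\mathcal I^{(\mathcal B)}(\widetilde g)\Bigr\}$$ admits a unique maximizer $\widetilde g^\star\in\widetilde{\mathcal W}^{(k)}_{\mathcal B}$. Moreover, any representative of $\widetilde g^\star$ has first component equal (a.e.) to $$g_{C^\star}(x,y)=\sum_{i,j=1}^kc^\star_{ij}\mathbf 1_{\mathcal B_i}(x)\mathbf 1_{\mathcal B_j}(y),$$ where $C^\star=(c^\star_{ij})_{i,j\in[k]}$ is the unique symmetric matrix in $[0,1]^{k\times k}$ solving the system $$c_{ij}=\frac{\exp\bigl(h_{ij}+\sum_{\ell=1}^kb_\ell\,c_{i\ell}c_{j\ell}\,\alpha_{ij\ell}\bigr)}{1+\exp\bigl(h_{ij}+\sum_{\ell=1}^kb_\ell\,c_{i\ell}c_{j\ell}\,\alpha_{ij\ell}\bigr)},\qquad i,j\in[k].$$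
   Context: Fix $k\in\mathbb N$ and $b_1,\dots,b_k>0$ with $\sum_i b_i=1$. $\mathcal B^{(k)}=(\mathcal B_1,\dots,\mathcal B_k)$ is the partition of $[0,1]$ into consecutive intervals with Lebesgue measure $\lambda(\mathcal B_i)=b_i$. Colored graphons. $\mathcal W$ is the set of measurable symmetric functions $g:[0,1]^2\to[0,1]$ (graphons), and $\mathcal W^{(k)}_{\mathcal B}=\mathcal W\times\{\mathcal B^{(k)}\}$. Set $$d^{(k)}_\square\bigl((g_1,\mathcal B^{(k)}),(g_2,\mathcal B^{(k)})\bigr)=\sup_{C,D\subseteq[0,1]}\sum_{i,j\in[k]}\Bigl|\int_{C\times D}\mathbf 1_{\mathcal B_i\times\mathcal B_j}(x,y)(g_1-g_2)(x,y)\,dx\,dy\Bigr|$$ (sup over measurable sets). $\Sigma_{\mathcal B}$ is the set of measure-preserving maps $\sigma:[0,1]\to[0,1]$ with $\lambda(\sigma^{-1}(\mathcal B_i)\triangle\mathcal B_i)=0$ for all $i\in[k]$; $g^\sigma(x,y)=g(\sigma(x),\sigma(y))$. Set $\delta^{(k)}_\square(g_1,g_2)=\inf_{\sigma\in\Sigma_{\mathcal B}}d^{(k)}_\square((g_1,\mathcal B^{(k)}),(g_2^\sigma,\mathcal B^{(k)}))$. $\widetilde{\mathcal W}^{(k)}_{\mathcal B}$ is the quotient of $\mathcal W^{(k)}_{\mathcal B}$ obtained by identifying colored graphons at $\delta^{(k)}_\square$-distance $0$ (in particular $(g,\mathcal B^{(k)})$ and $(g^\sigma,\mathcal B^{(k)})$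 are identified for $\sigma\in\Sigma_{\mathcal B}$), with metric $\delta^{(k)}_\square$. Functionals. For a finite simple graph $H$ on $[m]$ with edge set $\mathcal E(H)$ and $\boldsymbol\ell\in[k]^m$, $t^{(\mathcal B)}_{\boldsymbol\ell}(H,g)=\int_{\mathcal B_{\ell_1}\times\cdots\times\mathcal B_{\ell_m}}\prod_{\{i,j\}\in\mathcal E(H)}g(x_i,x_j)\,dx_1\cdots dx_m$. $H_1$ is a single edge, $H_2$ a triangle. With $I(u)=u\ln u+(1-u)\ln(1-u)$, $I(0)=I(1)=0$, and $g$ the first component of any representative of $\widetilde g$, $$\mathcal I^{(\mathcal B)}(\widetilde g)=\sum_{i,j\in[k]}\int_{\mathcal B_i\times\mathcal B_j}I(g(x,y))\,dx\,dy,$$ $$U^{(\mathcal B)}_{\boldsymbol\alpha,\mathbf h}(\widetilde g)=\frac16\sum_{i,j,\ell\in[k]}\alpha_{ij\ell}\,t^{(\mathcal B)}_{ij\ell}(H_2,g)+\frac12\sum_{i,j\in[k]}h_{ij}\,t^{(\mathcal B)}_{ij}(H_1,g);$$ these do not depend on the representative. *)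

theory Defs
  imports "HOL-Analysis.Analysis"
begin

text \<open>
  The index set of the first \<open>n\<close> positive integers is rendered as \<open>{..<n}\<close>, for colours as well
  as for vertices of graphs. ``Measurable'' means Lebesgue measurable. Functions on the unit
  interval or the unit square are total HOL functions whose values elsewhere are never looked at.
\<close>

text \<open>
  Consecutive intervals of prescribed lengths; which of two neighbouring intervals contains their
  common endpoint is left open. The ordering clause also makes the intervals disjoint.
\<close>
definition color_partition :: "nat \<Rightarrow> (nat \<Rightarrow> real) \<Rightarrow> (nat \<Rightarrow> real set) \<Rightarrow> bool" where
  "color_partition k b B \<longleftrightarrow>
     (\<Union>i<k. B i) = {0..1} \<and>
     (\<forall>i<k. is_interval (B i) \<and> measure lebesgue (B i) = b i) \<and>
     (\<forall>i j. i < j \<and> j < k \<longrightarrow> (\<forall>x\<in>B i. \<forall>y\<in>B j. x < y))"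

type_synonym kernel = "real \<times> real \<Rightarrow> real"
type_synonym colored_kernel = "kernel \<times> (nat \<Rightarrow> real set)"

definition graphons :: "kernel set" where
  "graphons = {g. g \<in> borel_measurable (lebesgue_on ({0..1} \<times> {0..1})) \<and>
     (\<forall>x\<in>{0..1}. \<forall>y\<in>{0..1}. 0 \<le> g (x, y) \<and> g (x, y) \<le> 1 \<and> g (x, y) = g (y, x))}"

definition colored_graphons :: "(nat \<Rightarrow> real set) \<Rightarrow> colored_kernel set" where
  "colored_graphons B = graphons \<times> {B}"

definition colored_cut_dist :: "nat \<Rightarrow> (nat \<Rightarrow> real set) \<Rightarrow> kernel \<Rightarrow> kernel \<Rightarrow> real" where
  "colored_cut_dist k B g1 g2 =
     (SUP (C, D) \<in> sets (lebesgue_on {0..1}) \<times> sets (lebesgue_on {0..1}).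
        \<Sum>i<k. \<Sum>j<k.
          \<bar>LINT z:C \<times> D|lebesgue. indicator (B i \<times> B j) z * (g1 z - g2 z)\<bar>)"

definition color_preserving_maps :: "nat \<Rightarrow> (nat \<Rightarrow> real set) \<Rightarrow> (real \<Rightarrow> real) set" where
  "color_preserving_maps k B = {\<sigma>.
     \<sigma> \<in> measurable (lebesgue_on {0..1}) (lebesgue_on {0..1}) \<and>
     distr (lebesgue_on {0..1}) (lebesgue_on {0..1}) \<sigma> = lebesgue_on {0..1} \<and>
     (\<forall>i<k. emeasure lebesgue (sym_diff (\<sigma> -` B i \<inter> {0..1}) (B i)) = 0)}"

definition relabel :: "(real \<Rightarrow> real) \<Rightarrow> kernel \<Rightarrow> kernel" where
  "relabel \<sigma> g = (\<lambda>(x, y). g (\<sigma> x, \<sigma> y))"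

definition colored_cut_metric :: "nat \<Rightarrow> (nat \<Rightarrow> real set) \<Rightarrow> kernel \<Rightarrow> kernel \<Rightarrow> real" where
  "colored_cut_metric k B g1 g2 =
     (INF \<sigma> \<in> color_preserving_maps k B. colored_cut_dist k B g1 (relabel \<sigma> g2))"

definition cut_equiv :: "nat \<Rightarrow> (nat \<Rightarrow> real set) \<Rightarrow> (colored_kernel \<times> colored_kernel) set" where
  "cut_equiv k B = {(u, v). u \<in> colored_graphons B \<and> v \<in> colored_graphons B \<and>
     colored_cut_metric k B (fst u) (fst v) = 0}"

definition quotient_graphons :: "nat \<Rightarrow> (nat \<Rightarrow> real set) \<Rightarrow> colored_kernel set set" where
  "quotient_graphons k B = colored_graphons B // cut_equiv k B"

text \<open>
  The graph has vertex set \<open>{..<length ls}\<close> and its edges are the two-element sets in \<open>E\<close>; the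
  orientation chosen by \<open>Min\<close> and \<open>Max\<close> is immaterial for symmetric kernels. The product measure
  is completed because the integrand need not be measurable for the product of the one-dimensional
  sigma-algebras when \<open>g\<close> is merely Lebesgue measurable.
\<close>
definition colored_density ::
  "(nat \<Rightarrow> real set) \<Rightarrow> nat list \<Rightarrow> nat set set \<Rightarrow> kernel \<Rightarrow> real" where
  "colored_density B ls E g =
     (LINT x:(\<Pi>\<^sub>E p\<in>{..<length ls}. B (ls ! p))|completion (\<Pi>\<^sub>M p\<in>{..<length ls}. lborel).
        \<Prod>e\<in>E. g (x (Min e), x (Max e)))"

definition edge_graph :: "nat set set" where
  "edge_graph = {{0, 1}}"

definition triangle_graph :: "nat set set" where
  "triangle_graph = {{0, 1}, {0, 2}, {1, 2}}"

text \<open>At \<open>0\<close> and \<open>1\<close> the formula gives the value \<open>0\<close>, since the factor in front of \<open>ln 0\<close> vanishes.\<close>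
definition neg_entropy :: "real \<Rightarrow> real" where
  "neg_entropy u = u * ln u + (1 - u) * ln (1 - u)"

text \<open>
  The functionals on the quotient are invariant under the choice of the representative, so that
  it may be picked by Hilbert choice.
\<close>
definition rep_kernel :: "colored_kernel set \<Rightarrow> kernel" where
  "rep_kernel X = fst (SOME u. u \<in> X)"

definition entropy_functional :: "nat \<Rightarrow> (nat \<Rightarrow> real set) \<Rightarrow> colored_kernel set \<Rightarrow> real" where
  "entropy_functional k B X =
     (\<Sum>i<k. \<Sum>j<k. LINT z:B i \<times> B j|lebesgue. neg_entropy (rep_kernel X z))"

definition energy_functional ::
  "nat \<Rightarrow> (nat \<Rightarrow> real set) \<Rightarrow> (nat \<Rightarrow> nat \<Rightarrow> nat \<Rightarrow> real) \<Rightarrow> (nat \<Rightarrow> nat \<Rightarrow> real) \<Rightarrow>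
     colored_kernel set \<Rightarrow> real" where
  "energy_functional k B \<alpha> h X =
     1/6 * (\<Sum>i<k. \<Sum>j<k. \<Sum>l<k.
        \<alpha> i j l * colored_density B [i, j, l] triangle_graph (rep_kernel X)) +
     1/2 * (\<Sum>i<k. \<Sum>j<k. h i j * colored_density B [i, j] edge_graph (rep_kernel X))"

definition is_maximizer ::
  "nat \<Rightarrow> (nat \<Rightarrow> real set) \<Rightarrow> (nat \<Rightarrow> nat \<Rightarrow> nat \<Rightarrow> real) \<Rightarrow> (nat \<Rightarrow> nat \<Rightarrow> real) \<Rightarrow>
     colored_kernel set \<Rightarrow> bool" where
  "is_maximizer k B \<alpha> h =
     is_arg_max (\<lambda>X. energy_functional k B \<alpha> h X - 1/2 * entropy_functional k B X)
       (\<lambda>X. X \<in> quotient_graphons k B)"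

definition max_norm3 :: "nat \<Rightarrow> (nat \<Rightarrow> nat \<Rightarrow> nat \<Rightarrow> real) \<Rightarrow> real" where
  "max_norm3 k \<alpha> = Max {\<bar>\<alpha> i j l\<bar> | i j l. i < k \<and> j < k \<and> l < k}"

text \<open>
  Matrices over \<open>{..<k}\<close> with entries in the unit interval are extensional functions, so that
  uniqueness is plain equality.
\<close>
definition solves_system ::
  "nat \<Rightarrow> (nat \<Rightarrow> real) \<Rightarrow> (nat \<Rightarrow> nat \<Rightarrow> nat \<Rightarrow> real) \<Rightarrow> (nat \<Rightarrow> nat \<Rightarrow> real) \<Rightarrow>
     (nat \<Rightarrow> nat \<Rightarrow> real) \<Rightarrow> bool" where
  "solves_system k b \<alpha> h C \<longleftrightarrow>
     C \<in> {..<k} \<rightarrow>\<^sub>E {..<k} \<rightarrow>\<^sub>E {0..1} \<and>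
     (\<forall>i<k. \<forall>j<k. C i j = C j i) \<and>
     (\<forall>i<k. \<forall>j<k. C i j =
        exp (h i j + (\<Sum>l<k. b l * C i l * C j l * \<alpha> i j l)) /
        (1 + exp (h i j + (\<Sum>l<k. b l * C i l * C j l * \<alpha> i j l))))"

definition block_kernel :: "nat \<Rightarrow> (nat \<Rightarrow> real set) \<Rightarrow> (nat \<Rightarrow> nat \<Rightarrow> real) \<Rightarrow> kernel" where
  "block_kernel k B C =
     (\<lambda>(x, y). \<Sum>i<k. \<Sum>j<k. C i j * indicator (B i) x * indicator (B j) y)"

end

theory Submission
  imports Defs
begin

text \<open>
  Let \<open>C\<close> solve the system, \<open>w = g - g\<^sub>C\<close>, and let \<open>A\<close> be the maximum norm of \<open>\<alpha>\<close>. Beyond the first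
  order in \<open>w\<close>, the triangle terms are at most \<open>A/2\<close> times the squared \<open>L\<^sup>2\<close> norm of \<open>w\<close>: the product
  of three edge values is expanded around the block values, and the remainder is bounded pointwise
  by the sum of the three squared deviations. The function \<open>1/2 I\<close> is strongly convex with
  \<open>1/2 I(u) \<ge> 1/2 I(c) + 1/2 I'(c) (u - c) + (u - c)\<^sup>2\<close>. The system says that the first-order terms
  cancel, so the objective at \<open>g\<close> is at most its value at \<open>g\<^sub>C\<close> minus \<open>(1 - A/2)\<close> times the squared norm
  of \<open>w\<close>. The system itself is a fixed point equation for a contraction with constant \<open>A/2 < 1\<close>.
  Since block kernels are invariant under colour-preserving relabelling, the class of \<open>g\<^sub>C\<close> consists
  exactly of the graphons that agree with \<open>g\<^sub>C\<close> almost everywhere.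
\<close>

section \<open>Products of Lebesgue measurable sets and maps\<close>

text \<open>The threshold 2 arises twice. In the comparison with the block kernel, the prefactor 1/6
  times three edges times A gives A/2, while \<open>neg_entropy\<close> has second derivative at
  least 4, so half of it contributes the constant 1. In the fixed point map, the logistic function
  has slope at most 1/4, a product of two entries varies at most twice as much as its factors, and
  the weights \<open>b\<close> sum to 1, which again gives A/2. Two obstacles shape the rest.
  Graphons are only Lebesgue measurable, while the triangle density composes them with pairs of
  coordinates of a product space; integrals are therefore moved to a Borel version, and null sets of
  the square have to be pulled back to the cube. Moreover, the metric is an infimum over
  relabellings that is not known to be attained, so distance 0 from a block kernel gives no map to
  work with. The way out is to fix a pair of test sets and to bound their gap uniformly over all
  relabellings, with test sets that may be chosen anew for each relabelling.\<close>

lemma null_sets_lborel_cylinder: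
  fixes N :: "'a::euclidean_space set"
  assumes "N \<in> null_sets lborel"
  shows "N \<times> (UNIV :: 'b::euclidean_space set) \<in> null_sets lborel"
    and "(UNIV :: 'b set) \<times> N \<in> null_sets lborel"
  using lborel.times_in_null_sets1[OF assms, of "UNIV :: 'b set"]
    lborel.times_in_null_sets2[OF _ assms, of "UNIV :: 'b set" lborel]
  by (auto simp: lborel_prod)

text \<open>Preimages of null sets under a projection are cylinders over null sets, hence null. This
  is the condition under which measurability survives completing the target.\<close>

lemma fst_measurable_lebesgue:
  "(fst :: 'a::euclidean_space \<times> 'b::euclidean_space \<Rightarrow> 'a) \<in> lebesgue \<rightarrow>\<^sub>M lebesgue"
proof (rule completion.measurable_completion2)
  show m: "(fst :: 'a \<times> 'b \<Rightarrow> 'a) \<in> lebesgue \<rightarrow>\<^sub>M lborel"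
    by (rule measurable_completion) (simp add: borel_prod[symmetric])
  have "fst -` N = N \<times> (UNIV :: 'b set)" for N :: "'a set" by auto
  then show "null_sets lborel \<subseteq> null_sets (distr lebesgue lborel (fst :: 'a \<times> 'b \<Rightarrow> 'a))"
    using null_sets_lborel_cylinder(1)[where 'b='b] m
    by (fastforce simp: null_sets_def emeasure_distr)
qed

lemma snd_measurable_lebesgue:
  "(snd :: 'a::euclidean_space \<times> 'b::euclidean_space \<Rightarrow> 'b) \<in> lebesgue \<rightarrow>\<^sub>M lebesgue"
proof (rule completion.measurable_completion2)
  show m: "(snd :: 'a \<times> 'b \<Rightarrow> 'b) \<in> lebesgue \<rightarrow>\<^sub>M lborel"
    by (rule measurable_completion) (simp add: borel_prod[symmetric])
  have "snd -` N = (UNIV :: 'a set) \<times> N" for N :: "'b set" by auto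
  then show "null_sets lborel \<subseteq> null_sets (distr lebesgue lborel (snd :: 'a \<times> 'b \<Rightarrow> 'b))"
    using null_sets_lborel_cylinder(2)[where 'b='a] m
    by (fastforce simp: null_sets_def emeasure_distr)
qed

lemma AE_lebesgue_fst:
  assumes "AE x in (lebesgue :: 'a::euclidean_space measure). P x"
  shows "AE z in (lebesgue :: ('a \<times> 'b::euclidean_space) measure). P (fst z)"
proof -
  from assms have "AE x in lborel. P x" by (simp add: AE_completion_iff)
  then obtain N where N: "N \<in> null_sets lborel" "{x. \<not> P x} \<subseteq> N"
    by (auto simp: eventually_ae_filter)
  have "AE z in (lborel :: ('a \<times> 'b) measure). P (fst z)"
    by (rule AE_I'[OF null_sets_lborel_cylinder(1)[OF N(1)]]) (use N(2) in auto)
  then show ?thesis by (simp add: AE_completion_iff)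
qed

lemma AE_lebesgue_snd:
  assumes "AE x in (lebesgue :: 'b::euclidean_space measure). P x"
  shows "AE z in (lebesgue :: ('a::euclidean_space \<times> 'b) measure). P (snd z)"
proof -
  from assms have "AE x in lborel. P x" by (simp add: AE_completion_iff)
  then obtain N where N: "N \<in> null_sets lborel" "{x. \<not> P x} \<subseteq> N"
    by (auto simp: eventually_ae_filter)
  have "AE z in (lborel :: ('a \<times> 'b) measure). P (snd z)"
    by (rule AE_I'[OF null_sets_lborel_cylinder(2)[OF N(1)]]) (use N(2) in auto)
  then show ?thesis by (simp add: AE_completion_iff)
qed

lemma Times_lebesgue_sets:
  fixes A :: "'a::euclidean_space set" and B :: "'b::euclidean_space set"
  assumes "A \<in> sets lebesgue" "B \<in> sets lebesgue"
  shows "A \<times> B \<in> sets lebesgue"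
proof -
  have "A \<times> B = (fst -` A \<inter> space lebesgue) \<inter> (snd -` B \<inter> space lebesgue)" by auto
  then show ?thesis
    using measurable_sets[OF fst_measurable_lebesgue assms(1)]
      measurable_sets[OF snd_measurable_lebesgue assms(2)]
    by (metis sets.Int)
qed

text \<open>Each factor is replaced by its Borel main part, for which the product formula is
  available; the two products differ by null cylinders.\<close>

lemma emeasure_lebesgue_Times:
  fixes A :: "'a::euclidean_space set" and B :: "'b::euclidean_space set"
  assumes A: "A \<in> sets lebesgue" and B: "B \<in> sets lebesgue"
  shows "emeasure lebesgue (A \<times> B) = emeasure lebesgue A * emeasure lebesgue B"
proof -
  let ?A = "main_part lborel A" and ?B = "main_part lborel B"
  have m: "?A \<in> sets borel" "?B \<in> sets borel"
    using main_part_sets[OF A] main_part_sets[OF B] by auto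
  have "AE z in (lebesgue :: ('a \<times> 'b) measure). fst z \<in> ?A \<longleftrightarrow> fst z \<in> A"
    using AE_in_main_part[OF A] by (intro AE_lebesgue_fst) (simp add: AE_completion_iff)
  moreover have "AE z in (lebesgue :: ('a \<times> 'b) measure). snd z \<in> ?B \<longleftrightarrow> snd z \<in> B"
    using AE_in_main_part[OF B] by (intro AE_lebesgue_snd) (simp add: AE_completion_iff)
  ultimately have "AE z in (lebesgue :: ('a \<times> 'b) measure). z \<in> A \<times> B \<longleftrightarrow> z \<in> ?A \<times> ?B"
    by eventually_elim (auto simp: mem_Times_iff)
  moreover have AB: "?A \<times> ?B \<in> sets lborel"
    using m by (subst lborel_prod[symmetric]) auto
  ultimately have "emeasure lebesgue (A \<times> B) = emeasure lebesgue (?A \<times> ?B)"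
    using A B by (intro emeasure_eq_AE Times_lebesgue_sets) auto
  also have "\<dots> = emeasure (lborel \<Otimes>\<^sub>M lborel) (?A \<times> ?B)"
    using AB by (simp add: lborel_prod emeasure_completion)
  also have "\<dots> = emeasure lborel ?A * emeasure lborel ?B"
    using m by (intro lborel.emeasure_pair_measure_Times) auto
  finally show ?thesis using A B by (simp add: emeasure_completion)
qed

lemma sigma_finite_lebesgue: "sigma_finite_measure (lebesgue :: 'a::euclidean_space measure)"
proof
  obtain F :: "nat \<Rightarrow> 'a set" where F: "range F \<subseteq> sets lborel" "(\<Union>i. F i) = space lborel"
      "\<And>i. emeasure lborel (F i) \<noteq> \<infinity>"
    using lborel.sigma_finite by blast
  then show "\<exists>A::'a set set. countable A \<and> A \<subseteq> sets lebesgue \<and> \<Union>A = space lebesgue \<and>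
      (\<forall>a\<in>A. emeasure lebesgue a \<noteq> \<infinity>)"
    by (intro exI[of _ "range F"]) (auto simp: emeasure_completion)
qed

text \<open>The product of two completions need not contain all Lebesgue sets of the product space.
  The identity map passes from the completed space to that coarser one, so results on product
  measures can be used for \<open>lebesgue\<close>.\<close>

lemma distr_lebesgue_pair:
  "(\<lambda>z. z) \<in> (lebesgue :: ('a::euclidean_space \<times> 'b::euclidean_space) measure) \<rightarrow>\<^sub>M lebesgue \<Otimes>\<^sub>M lebesgue"
  "distr (lebesgue :: ('a \<times> 'b) measure) (lebesgue \<Otimes>\<^sub>M lebesgue) (\<lambda>z. z) = lebesgue \<Otimes>\<^sub>M lebesgue"
proof -
  show m: "(\<lambda>z. z) \<in> (lebesgue :: ('a \<times> 'b) measure) \<rightarrow>\<^sub>M lebesgue \<Otimes>\<^sub>M lebesgue"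
    using measurable_Pair[OF fst_measurable_lebesgue snd_measurable_lebesgue] by simp
  show "distr (lebesgue :: ('a \<times> 'b) measure) (lebesgue \<Otimes>\<^sub>M lebesgue) (\<lambda>z. z) = lebesgue \<Otimes>\<^sub>M lebesgue"
    by (rule sym, rule pair_measure_eqI)
      (use m in \<open>auto intro!: sigma_finite_lebesgue simp: emeasure_distr emeasure_lebesgue_Times\<close>)
qed

text \<open>A product of pushforwards is the pushforward of the product, for uncompleted product
  measures. The map is therefore aimed at \<open>lborel\<close>, and its source is changed to
  \<open>lebesgue\<close> through the identity. Completing the target at the end is allowed because
  null sets pull back to null sets.\<close>

lemma map_prod_preserves_lebesgue:
  fixes \<tau> :: "'a::euclidean_space \<Rightarrow> 'a"
  assumes m: "\<tau> \<in> lebesgue \<rightarrow>\<^sub>M lebesgue" and d: "distr lebesgue lebesgue \<tau> = lebesgue"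
  shows "map_prod \<tau> \<tau> \<in> lebesgue \<rightarrow>\<^sub>M lebesgue" "distr lebesgue lebesgue (map_prod \<tau> \<tau>) = lebesgue"
proof -
  have id: "(\<lambda>x. x) \<in> (lebesgue :: 'a measure) \<rightarrow>\<^sub>M lborel"
    by (rule measurable_completion) simp
  have m': "\<tau> \<in> lebesgue \<rightarrow>\<^sub>M lborel"
    using measurable_comp[OF m id] by (simp add: comp_def)
  have "distr lebesgue lborel \<tau> = distr (distr lebesgue lebesgue \<tau>) lborel (\<lambda>x. x)"
    using m id by (simp add: distr_distr comp_def)
  also have "\<dots> = lborel"
    unfolding d by (subst distr_completion) (auto simp: distr_id)
  finally have d': "distr lebesgue lborel \<tau> = lborel" .
  have mp: "map_prod \<tau> \<tau> = (\<lambda>(x, y). (\<tau> x, \<tau> y))" by auto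
  have T: "map_prod \<tau> \<tau> \<in> lebesgue \<Otimes>\<^sub>M lebesgue \<rightarrow>\<^sub>M lborel \<Otimes>\<^sub>M lborel"
    unfolding mp using m' by measurable
  have "distr lebesgue lborel \<tau> \<Otimes>\<^sub>M distr lebesgue lborel \<tau> =
      distr (lebesgue \<Otimes>\<^sub>M lebesgue) (lborel \<Otimes>\<^sub>M lborel) (map_prod \<tau> \<tau>)"
    unfolding mp using m' by (intro pair_measure_distr) (auto simp: d' sigma_finite_lborel)
  also have "\<dots> = distr (distr lebesgue (lebesgue \<Otimes>\<^sub>M lebesgue) (\<lambda>z. z)) (lborel \<Otimes>\<^sub>M lborel) (map_prod \<tau> \<tau>)"
    by (simp only: distr_lebesgue_pair(2))
  also have "\<dots> = distr lebesgue (lborel \<Otimes>\<^sub>M lborel) (map_prod \<tau> \<tau>)"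
    using T by (simp add: distr_distr distr_lebesgue_pair(1) comp_def)
  finally have D: "distr lebesgue lborel (map_prod \<tau> \<tau>) = lborel"
    by (simp add: d' lborel_prod)
  have M: "map_prod \<tau> \<tau> \<in> lebesgue \<rightarrow>\<^sub>M lborel"
    using measurable_comp[OF distr_lebesgue_pair(1) T] by (simp add: comp_def lborel_prod)
  show "map_prod \<tau> \<tau> \<in> lebesgue \<rightarrow>\<^sub>M lebesgue"
    by (rule completion.measurable_completion2[OF M]) (simp add: D)
  show "distr lebesgue lebesgue (map_prod \<tau> \<tau>) = lebesgue"
    using completion.completion_distr_eq[OF M] by (simp add: D)
qed

section \<open>Entropy and the fixed point system\<close>

text \<open>This is Pinsker's inequality for two-point distributions. The argument \<open>u\<close>
  stays fixed and the reference point \<open>t\<close> moves from \<open>c\<close> down to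
  \<open>u\<close>, where both sides agree; the derivative in \<open>t\<close> is
  \<open>(u - t) * (1 / (t * (1 - t)) - 4)\<close>, and its sign is clear because
  \<open>t * (1 - t)\<close> is at most 1/4.\<close>

lemma neg_entropy_tangent_bound_left:
  fixes c u :: real
  assumes u: "0 \<le> u" and uc: "u \<le> c" and c: "c < 1"
  shows "u * ln c + (1 - u) * ln (1 - c) + 2 * (u - c)\<^sup>2 \<le> neg_entropy u"
proof -
  define G where "G t = u * ln t + (1 - u) * ln (1 - t) + 2 * (u - t)\<^sup>2" for t :: real
  have "continuous_on {u..c} (\<lambda>t. u * ln t)"
  \<comment> \<open>For \<open>u = 0\<close> the interval reaches the singularity of the logarithm,
    but the term is then identically 0.\<close>
  proof (cases "u = 0")
    case False
    then show ?thesis using u by (intro continuous_intros) auto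
  qed simp
  moreover have "continuous_on {u..c} (\<lambda>t. (1 - u) * ln (1 - t))" "continuous_on {u..c} (\<lambda>t. 2 * (u - t)\<^sup>2)"
    using c by (auto intro!: continuous_intros)
  ultimately have cont: "continuous_on {u..c} G"
    unfolding G_def by (intro continuous_on_add)
  have "G c \<le> G u"
  proof (rule DERIV_nonpos_imp_decreasing_open[OF uc _ cont])
    fix t assume t: "u < t" "t < c"
    then have t': "0 < t" "t < 1" using u c by auto
    have "(G has_real_derivative u / t - (1 - u) / (1 - t) - 4 * (u - t)) (at t)"
      unfolding G_def using t' by (auto intro!: derivative_eq_intros simp: algebra_simps diff_divide_distrib)
    moreover have "u / t - (1 - u) / (1 - t) - 4 * (u - t) = (u - t) * (1 / (t * (1 - t)) - 4)"
      using t' by (simp add: divide_simps) (simp add: algebra_simps)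
    moreover have "4 * (t * (1 - t)) \<le> 1"
      using zero_le_power2[of "2 * t - 1"] by (simp add: power2_eq_square algebra_simps)
    then have "4 \<le> 1 / (t * (1 - t))"
      using t' by (simp add: pos_le_divide_eq)
    then have "(u - t) * (1 / (t * (1 - t)) - 4) \<le> 0"
      using t by (intro mult_nonpos_nonneg) auto
    ultimately show "\<exists>y. (G has_real_derivative y) (at t) \<and> y \<le> 0" by metis
  qed
  then show ?thesis by (simp add: G_def neg_entropy_def)
qed

text \<open>The reflection of \<open>u\<close> and \<open>c\<close> in 1/2 reduces the case
  \<open>c < u\<close> to the previous lemma. The expression bounded there is the tangent of
  \<open>neg_entropy\<close> at \<open>c\<close>, written out at \<open>u\<close>.\<close>

lemma neg_entropy_tangent_bound:
  fixes c u :: real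
  assumes u: "0 \<le> u" "u \<le> 1" and c: "0 < c" "c < 1"
  shows "neg_entropy c + (ln c - ln (1 - c)) * (u - c) + 2 * (u - c)\<^sup>2 \<le> neg_entropy u"
proof -
  have "u * ln c + (1 - u) * ln (1 - c) + 2 * (u - c)\<^sup>2 \<le> neg_entropy u"
  proof (cases "u \<le> c")
    case True
    then show ?thesis using u c by (intro neg_entropy_tangent_bound_left)
  next
    case False
    then have "(1 - u) * ln (1 - c) + (1 - (1 - u)) * ln (1 - (1 - c)) + 2 * ((1 - u) - (1 - c))\<^sup>2
        \<le> neg_entropy (1 - u)"
      using u c by (intro neg_entropy_tangent_bound_left) auto
    then show ?thesis by (simp add: neg_entropy_def power2_commute add.commute)
  qed
  then show ?thesis by (simp add: neg_entropy_def algebra_simps)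
qed

lemma mult_le_half_sum_squares:
  fixes u v s :: real
  assumes "0 \<le> s" "s \<le> 1"
  shows "\<bar>u * v * s\<bar> \<le> (u\<^sup>2 + v\<^sup>2) / 2"
proof -
  have "\<bar>u * v * s\<bar> \<le> \<bar>u\<bar> * \<bar>v\<bar> * 1"
    unfolding abs_mult using assms by (intro mult_left_mono) auto
  also have "\<dots> \<le> (u\<^sup>2 + v\<^sup>2) / 2"
    using zero_le_power2[of "\<bar>u\<bar> - \<bar>v\<bar>"] by (simp add: power2_diff)
  finally show ?thesis .
qed

text \<open>The remainder consists of three terms quadratic in the deviations and one cubic. The
  cubic term is shared in thirds among the quadratic ones, which turns a coefficient
  \<open>c\<close> into \<open>(2 * c + z) / 3\<close>. This still lies in the unit interval, so the
  constant stays 1: every square arises from two of the three products, each time with weight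
  1/2.\<close>

lemma triple_product_expansion:
  fixes a b c x y z :: real
  assumes "a \<in> {0..1}" "b \<in> {0..1}" "c \<in> {0..1}" "x \<in> {0..1}" "y \<in> {0..1}" "z \<in> {0..1}"
  shows "\<bar>x * y * z - (a * b * c + b * c * (x - a) + a * c * (y - b) + a * b * (z - c))\<bar>
    \<le> (x - a)\<^sup>2 + (y - b)\<^sup>2 + (z - c)\<^sup>2"
proof -
  define P where "P = (x - a) * (y - b) * ((2 * c + z) / 3)"
  define Q where "Q = (x - a) * (z - c) * ((2 * b + y) / 3)"
  define R where "R = (y - b) * (z - c) * ((2 * a + x) / 3)"
  have eq: "x * y * z - (a * b * c + b * c * (x - a) + a * c * (y - b) + a * b * (z - c)) =
      P + Q + R"
    unfolding P_def Q_def R_def by (simp add: field_simps)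
  have PQR: "\<bar>P\<bar> \<le> ((x - a)\<^sup>2 + (y - b)\<^sup>2) / 2" "\<bar>Q\<bar> \<le> ((x - a)\<^sup>2 + (z - c)\<^sup>2) / 2"
    "\<bar>R\<bar> \<le> ((y - b)\<^sup>2 + (z - c)\<^sup>2) / 2"
    unfolding P_def Q_def R_def using assms by (intro mult_le_half_sum_squares; simp)+
  have "\<bar>P + Q + R\<bar> \<le> (x - a)\<^sup>2 + (y - b)\<^sup>2 + (z - c)\<^sup>2"
    using PQR abs_triangle_ineq[of "P + Q" R] abs_triangle_ineq[of P Q] by (simp add: field_simps)
  then show ?thesis by (simp only: eq)
qed

section \<open>The logistic function\<close>

definition logistic :: "real \<Rightarrow> real" where
  "logistic t = exp t / (1 + exp t)"

lemma logistic_bounds: "0 < logistic t" "logistic t < 1"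
  by (simp_all add: logistic_def add_pos_pos divide_less_eq)

text \<open>The log-odds is the derivative of \<open>neg_entropy\<close>, and
  \<open>logistic\<close> inverts it. At a solution of the system the slope of the entropy at an
  entry is therefore the exponent belonging to that entry.\<close>

lemma ln_logistic: "ln (logistic t) - ln (1 - logistic t) = t"
proof -
  have p: "0 < 1 + exp t" by (simp add: add_pos_pos)
  have "1 - logistic t = 1 / (1 + exp t)"
    using p by (simp add: logistic_def field_simps)
  then show ?thesis using p by (simp add: logistic_def ln_div)
qed

lemma logistic_lipschitz_le:
  assumes "s < t"
  shows "\<bar>logistic t - logistic s\<bar> \<le> (t - s) / 4"
proof -
  have D: "(logistic has_real_derivative (logistic x * (1 - logistic x))) (at x)" for x
  proof -
    have p: "1 + exp x \<noteq> 0" using exp_gt_zero[of x] by linarith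
    have "(logistic has_real_derivative
        ((exp x * (1 + exp x) - exp x * exp x) / ((1 + exp x) * (1 + exp x)))) (at x)"
      unfolding logistic_def[abs_def] using p by (auto intro!: derivative_eq_intros)
    moreover have "(exp x * (1 + exp x) - exp x * exp x) / ((1 + exp x) * (1 + exp x)) =
        logistic x * (1 - logistic x)"
      using p by (simp add: logistic_def field_simps)
    ultimately show ?thesis by simp
  qed
  obtain z where z: "logistic t - logistic s = (t - s) * (logistic z * (1 - logistic z))"
    using MVT2[OF assms, of logistic "\<lambda>x. logistic x * (1 - logistic x)"] D by blast
  have "logistic z * (1 - logistic z) \<le> 1 / 4"
    using zero_le_power2[of "2 * logistic z - 1"] by (simp add: power2_eq_square algebra_simps)
  moreover have "0 \<le> logistic z * (1 - logistic z)"
    using logistic_bounds[of z] by simp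
  ultimately show ?thesis
    unfolding z using assms mult_left_mono[of "logistic z * (1 - logistic z)" "1/4" "t - s"]
    by (simp add: abs_mult)
qed

lemma logistic_lipschitz: "\<bar>logistic t - logistic s\<bar> \<le> \<bar>t - s\<bar> / 4"
  using logistic_lipschitz_le[of s t] logistic_lipschitz_le[of t s]
  by (cases s t rule: linorder_cases) (auto simp: abs_minus_commute)

section \<open>The fixed point system as a contraction\<close>

text \<open>\<open>A\<close> may be any bound on the entries of \<alpha>; it is instantiated by the
  maximum norm at the end. The symmetry of \<alpha> is encoded by a transposition and a rotation,
  which generate all permutations of three indices.\<close>

locale block_system =
  fixes k :: nat and b :: "nat \<Rightarrow> real" and \<alpha> :: "nat \<Rightarrow> nat \<Rightarrow> nat \<Rightarrow> real"
    and h :: "nat \<Rightarrow> nat \<Rightarrow> real" and A :: real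
  assumes b_pos: "\<And>i. i < k \<Longrightarrow> 0 < b i" and b_sum: "(\<Sum>i<k. b i) = 1"
    and \<alpha>_swap: "\<And>i j l. i < k \<Longrightarrow> j < k \<Longrightarrow> l < k \<Longrightarrow> \<alpha> i j l = \<alpha> j i l"
    and \<alpha>_rot: "\<And>i j l. i < k \<Longrightarrow> j < k \<Longrightarrow> l < k \<Longrightarrow> \<alpha> i j l = \<alpha> j l i"
    and h_sym: "\<And>i j. i < k \<Longrightarrow> j < k \<Longrightarrow> h i j = h j i"
    and \<alpha>_le: "\<And>i j l. i < k \<Longrightarrow> j < k \<Longrightarrow> l < k \<Longrightarrow> \<bar>\<alpha> i j l\<bar> \<le> A"
    and A_nonneg: "0 \<le> A" and A_less: "A < 2"
begin

definition field :: "(nat \<Rightarrow> nat \<Rightarrow> real) \<Rightarrow> nat \<Rightarrow> nat \<Rightarrow> real" where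
  "field C i j = h i j + (\<Sum>l<k. b l * C i l * C j l * \<alpha> i j l)"

lemma solves_system_iff:
  "solves_system k b \<alpha> h C \<longleftrightarrow> C \<in> {..<k} \<rightarrow>\<^sub>E {..<k} \<rightarrow>\<^sub>E {0..1} \<and>
     (\<forall>i<k. \<forall>j<k. C i j = C j i) \<and> (\<forall>i<k. \<forall>j<k. C i j = logistic (field C i j))"
  by (simp add: solves_system_def logistic_def field_def)

lemma field_cong:
  assumes "\<And>i j. i < k \<Longrightarrow> j < k \<Longrightarrow> C i j = D i j" "i < k" "j < k"
  shows "field C i j = field D i j"
  using assms by (simp add: field_def)

text \<open>The term \<open>h\<close> cancels in the difference of the fields. Splitting the
  difference of two products into single differences costs a factor 2, averaging with the weights
  \<open>b\<close> costs nothing, and the slope of \<open>logistic\<close> gains 1/4.\<close>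

lemma logistic_field_contraction:
  assumes C: "\<And>i j. i < k \<Longrightarrow> j < k \<Longrightarrow> C i j \<in> {0..1}"
    and D: "\<And>i j. i < k \<Longrightarrow> j < k \<Longrightarrow> D i j \<in> {0..1}"
    and m: "\<And>i j. i < k \<Longrightarrow> j < k \<Longrightarrow> \<bar>C i j - D i j\<bar> \<le> m"
    and ij: "i < k" "j < k"
  shows "\<bar>logistic (field C i j) - logistic (field D i j)\<bar> \<le> A / 2 * m"
proof -
  have "0 \<le> m" using m[OF ij] by linarith
  have "\<bar>field C i j - field D i j\<bar> = \<bar>\<Sum>l<k. b l * \<alpha> i j l * (C i l * C j l - D i l * D j l)\<bar>"
    unfolding field_def by (simp add: sum_subtractf[symmetric] algebra_simps)
  also have "\<dots> \<le> (\<Sum>l<k. b l * (A * (2 * m)))"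
  proof (rule order_trans[OF sum_abs], rule sum_mono)
    fix l assume "l \<in> {..<k}"
    then have l: "l < k" by simp
    have "C i l * C j l - D i l * D j l = (C i l - D i l) * C j l + D i l * (C j l - D j l)"
      by (simp add: algebra_simps)
    also have "\<bar>\<dots>\<bar> \<le> \<bar>C i l - D i l\<bar> * C j l + D i l * \<bar>C j l - D j l\<bar>"
      using C[OF ij(2) l] D[OF ij(1) l] by (intro order_trans[OF abs_triangle_ineq]) (simp add: abs_mult)
    also have "\<dots> \<le> m * 1 + 1 * m"
      using C[OF ij(2) l] D[OF ij(1) l] m[OF ij(1) l] m[OF ij(2) l] \<open>0 \<le> m\<close>
      by (intro add_mono mult_mono) auto
    finally have "\<bar>C i l * C j l - D i l * D j l\<bar> \<le> 2 * m" by simp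
    then have "b l * (\<bar>\<alpha> i j l\<bar> * \<bar>C i l * C j l - D i l * D j l\<bar>) \<le> b l * (A * (2 * m))"
      using b_pos[OF l] \<alpha>_le[OF ij l] A_nonneg by (intro mult_left_mono mult_mono) auto
    then show "\<bar>b l * \<alpha> i j l * (C i l * C j l - D i l * D j l)\<bar> \<le> b l * (A * (2 * m))"
      using b_pos[OF l] by (simp add: abs_mult mult.assoc)
  qed
  also have "\<dots> = A * (2 * m)"
    by (simp add: sum_distrib_right[symmetric] b_sum)
  finally show ?thesis
    using logistic_lipschitz[of "field C i j" "field D i j"] by simp
qed

lemma solves_system_unique:
  assumes C: "solves_system k b \<alpha> h C" and D: "solves_system k b \<alpha> h D"
  shows "C = D"
proof -
  have "k \<noteq> 0" using b_sum by (intro notI) simp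
  define m where "m = Max ((\<lambda>(i, j). \<bar>C i j - D i j\<bar>) ` ({..<k} \<times> {..<k}))"
  have bound: "\<bar>C i j - D i j\<bar> \<le> m" if "i < k" "j < k" for i j
    unfolding m_def using that by (intro Max_ge) auto
  \<comment> \<open>The maximum is attained because \<open>k\<close> is positive, so the contraction
    can be applied at a maximal entry and bounds \<open>m\<close> by a fraction of itself.\<close>
  have "m \<in> (\<lambda>(i, j). \<bar>C i j - D i j\<bar>) ` ({..<k} \<times> {..<k})"
    unfolding m_def using \<open>k \<noteq> 0\<close> by (intro Max_in) (auto simp: lessThan_empty_iff)
  then obtain i j where ij: "i < k" "j < k" "m = \<bar>C i j - D i j\<bar>" by auto
  have "C i j = logistic (field C i j)" "D i j = logistic (field D i j)"
    using C D ij by (auto simp: solves_system_iff)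
  then have "m \<le> A / 2 * m"
    using logistic_field_contraction[of C D m i j] C D bound ij
    by (auto simp: solves_system_iff PiE_iff)
  then have "(1 - A / 2) * m \<le> 0" by (simp add: algebra_simps)
  then have "m \<le> 0" using A_less by (simp add: mult_le_0_iff)
  then have "C i j = D i j" if "i < k" "j < k" for i j
    using bound[OF that] by linarith
  note eq = this
  have CD: "C \<in> {..<k} \<rightarrow>\<^sub>E {..<k} \<rightarrow>\<^sub>E {0..1}" "D \<in> {..<k} \<rightarrow>\<^sub>E {..<k} \<rightarrow>\<^sub>E {0..1}"
    using C D by (simp_all only: solves_system_iff)
  show ?thesis
  proof (rule PiE_ext[OF CD])
    fix i assume i: "i \<in> {..<k}"
    show "C i = D i"
      by (rule PiE_ext[OF PiE_mem[OF CD(1) i] PiE_mem[OF CD(2) i]]) (use eq i in simp)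
  qed
qed

text \<open>Picard iteration from the zero matrix: the steps decay geometrically, so every entry
  converges, and continuity makes the limit a fixed point. \<open>field\<close> is symmetric in its
  two indices for any matrix, which makes all iterates and hence the limit symmetric.\<close>

lemma solves_system_exists: "\<exists>C. solves_system k b \<alpha> h C"
proof -
  define X where "X n = ((\<lambda>C i j. logistic (field C i j)) ^^ n) (\<lambda>_ _. 0)" for n
  have X_Suc: "X (Suc n) i j = logistic (field (X n) i j)" for n i j
    by (simp add: X_def)
  have X01: "X n i j \<in> {0..1}" for n i j
  proof (cases n)
    case (Suc m)
    then show ?thesis
      using logistic_bounds[of "field (X m) i j"] X_Suc[of m i j] by simp
  qed (simp add: X_def)
  \<comment> \<open>The bound starts at 1 because the first iterate lies in the unit interval and
    the zeroth is 0.\<close>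
  have step: "\<bar>X (Suc n) i j - X n i j\<bar> \<le> (A / 2) ^ n" if "i < k" "j < k" for n i j
    using that
  proof (induction n arbitrary: i j)
    case 0
    show ?case using X01[of 1 i j] by (simp add: X_def)
  next
    case (Suc n)
    have "\<bar>logistic (field (X (Suc n)) i j) - logistic (field (X n) i j)\<bar> \<le> A / 2 * (A / 2) ^ n"
      by (rule logistic_field_contraction) (use Suc X01 in auto)
    then show ?case by (simp add: X_Suc)
  qed
  have conv: "convergent (\<lambda>n. X n i j)" if "i < k" "j < k" for i j
  proof -
    have "summable (\<lambda>n. (A / 2) ^ n)"
      using A_nonneg A_less by (intro summable_geometric) auto
    then have "summable (\<lambda>n. X (Suc n) i j - X n i j)"
      by (rule summable_comparison_test'[where N = 0]) (use step[OF that] in \<open>simp only: real_norm_def\<close>)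
    then have "convergent (\<lambda>n. \<Sum>m<n. X (Suc m) i j - X m i j)"
      by (simp only: summable_iff_convergent)
    then show ?thesis
      by (simp only: sum_lessThan_telescope[of "\<lambda>n. X n i j"] convergent_diff_const_right_iff)
  qed
  define L where "L i j = lim (\<lambda>n. X n i j)" for i j
  have L: "(\<lambda>n. X n i j) \<longlonglongrightarrow> L i j" if "i < k" "j < k" for i j
    using conv[OF that] by (simp add: L_def convergent_LIMSEQ_iff)
  have fix_L: "L i j = logistic (field L i j)" if ij: "i < k" "j < k" for i j
  proof (rule LIMSEQ_unique)
    show "(\<lambda>n. X (Suc n) i j) \<longlonglongrightarrow> L i j"
      using L[OF ij] by (rule LIMSEQ_Suc)
    have nz: "1 + exp (h i j + (\<Sum>l<k. b l * L i l * L j l * \<alpha> i j l)) \<noteq> 0"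
      using exp_gt_zero[of "h i j + (\<Sum>l<k. b l * L i l * L j l * \<alpha> i j l)"] by linarith
    show "(\<lambda>n. X (Suc n) i j) \<longlonglongrightarrow> logistic (field L i j)"
      unfolding X_Suc logistic_def field_def using L ij nz by (intro tendsto_intros) auto
  qed
  have X_sym: "X n i j = X n j i" if "i < k" "j < k" for n i j
  proof (cases n)
    case (Suc m)
    have "field (X m) i j = field (X m) j i"
      unfolding field_def using that h_sym \<alpha>_swap by (auto intro!: sum.cong)
    then show ?thesis by (simp add: Suc X_Suc)
  qed (simp add: X_def)
  have L_sym: "L i j = L j i" if "i < k" "j < k" for i j
    using X_sym[OF that] by (simp add: L_def)
  \<comment> \<open>The limit is cut down to the index range, since solutions are extensional
    functions.\<close>
  define C where "C = (\<lambda>i\<in>{..<k}. \<lambda>j\<in>{..<k}. L i j)"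
  have C: "C i j = L i j" if "i < k" "j < k" for i j
    using that by (simp add: C_def)
  have "C \<in> {..<k} \<rightarrow>\<^sub>E {..<k} \<rightarrow>\<^sub>E {0..1}"
    unfolding C_def using fix_L logistic_bounds by (auto simp: less_imp_le)
  moreover have "field C i j = field L i j" if "i < k" "j < k" for i j
    by (rule field_cong) (use C that in auto)
  ultimately have "solves_system k b \<alpha> h C"
    unfolding solves_system_iff using fix_L L_sym C by simp
  then show ?thesis by blast
qed

end

section \<open>Marginals of boxes in finite products\<close>

text \<open>Preimages under \<open>f\<close> and \<open>f'\<close> differ by null sets only, and
  such differences are invisible to measurability in the completion.\<close>

lemma completion_measurable_AE_eq:
  assumes f': "f' \<in> M \<rightarrow>\<^sub>M N" and eq: "AE x in M. f x = f' x" and f: "\<And>x. x \<in> space M \<Longrightarrow> f x \<in> space N"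
  shows "f \<in> completion M \<rightarrow>\<^sub>M N"
proof (rule measurableI)
  fix A assume A: "A \<in> sets N"
  have "AE x in completion M. (x \<in> f' -` A \<inter> space M) = (x \<in> f -` A \<inter> space M)"
    using eq by (auto simp: AE_completion_iff)
  moreover have "f' -` A \<inter> space M \<in> sets (completion M)"
    using f' A by (auto intro: measurable_sets)
  ultimately have "f -` A \<inter> space M \<in> sets (completion M)"
    by (rule completion.in_sets_AE) simp
  then show "f -` A \<inter> space (completion M) \<in> sets (completion M)" by simp
qed (use f in auto)

text \<open>This evaluates integrals over \<open>lebesgue\<close> and over completed finite products
  through a Borel integrand, when the original integrand is not known to be measurable for
  \<open>M\<close>.\<close>

lemma integral_completion_AE_eq:
  fixes f f' :: "'a \<Rightarrow> real"
  assumes f': "f' \<in> borel_measurable M" and eq: "AE x in M. f x = f' x"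
  shows "integral\<^sup>L (completion M) f = integral\<^sup>L M f'"
proof -
  have "integral\<^sup>L (completion M) f = integral\<^sup>L (completion M) f'"
    using completion_measurable_AE_eq[OF f' eq] f' eq
    by (intro integral_cong_AE) (auto simp: AE_completion_iff measurable_completion)
  then show ?thesis using f' by (simp add: integral_completion)
qed

lemma measurable_pair_component:
  assumes "p \<in> I" "q \<in> I"
  shows "(\<lambda>x. (x p, x q)) \<in> (\<Pi>\<^sub>M i\<in>I. (lborel :: real measure)) \<rightarrow>\<^sub>M borel"
proof -
  have "(\<lambda>x. x i) \<in> (\<Pi>\<^sub>M i\<in>I. (lborel :: real measure)) \<rightarrow>\<^sub>M borel" if "i \<in> I" for i
    using measurable_component_singleton[OF that, of "\<lambda>_. lborel :: real measure"] by simp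
  then show ?thesis using assms by (intro borel_measurable_Pair)
qed

lemma emeasure_PiM_lborel:
  assumes "finite I" "\<And>i. i \<in> I \<Longrightarrow> L i \<in> sets borel"
  shows "emeasure (\<Pi>\<^sub>M i\<in>I. (lborel :: real measure)) (Pi\<^sub>E I L) = (\<Prod>i\<in>I. emeasure lborel (L i))"
proof -
  interpret product_sigma_finite "\<lambda>_. lborel :: real measure" ..
  show ?thesis using assms by (intro emeasure_PiM) auto
qed

lemma sets_PiE_lborel:
  assumes "finite I" "\<And>i. i \<in> I \<Longrightarrow> L i \<in> sets borel"
  shows "Pi\<^sub>E I L \<in> sets (\<Pi>\<^sub>M i\<in>I. (lborel :: real measure))"
  using assms by (intro sets_PiM_I_finite) auto

text \<open>Integrating out the coordinates other than \<open>p\<close> and \<open>q\<close>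
  contributes the product of their side lengths. Both measures are compared on rectangles.\<close>

lemma distr_PiM_box_pair:
  fixes L :: "'i \<Rightarrow> real set"
  assumes I: "finite I" and pq: "p \<in> I" "q \<in> I" "p \<noteq> q"
    and L: "\<And>i. i \<in> I \<Longrightarrow> L i \<in> sets borel" "\<And>i. i \<in> I \<Longrightarrow> emeasure lborel (L i) < \<infinity>"
  defines "P \<equiv> \<Pi>\<^sub>M i\<in>I. (lborel :: real measure)"
  shows "distr (density P (indicator (Pi\<^sub>E I L))) lborel (\<lambda>x. (x p, x q)) =
    density lborel (\<lambda>z. ennreal ((\<Prod>i\<in>I - {p, q}. measure lborel (L i)) * indicator (L p \<times> L q) z))"
proof -
  define K where "K = (\<Prod>i\<in>I - {p, q}. measure lborel (L i))"
  have K: "0 \<le> K" unfolding K_def by (intro prod_nonneg) auto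
  have m: "(\<lambda>x. (x p, x q)) \<in> P \<rightarrow>\<^sub>M lborel"
    using measurable_pair_component[OF pq(1,2)] by (simp add: P_def)
  have [measurable]: "L p \<in> sets borel" "L q \<in> sets borel" using L pq by auto
  \<comment> \<open>The constant \<open>K\<close> is carried by the first factor alone, which
    presents the target as a product of two finite measures, determined by its values on
    rectangles.\<close>
  let ?M1 = "density (lborel :: real measure) (\<lambda>x. ennreal K * indicator (L p) x)"
  let ?M2 = "density (lborel :: real measure) (indicator (L q))"
  let ?D = "distr (density P (indicator (Pi\<^sub>E I L))) lborel (\<lambda>x. (x p, x q))"
  have e1: "emeasure ?M1 A = ennreal K * emeasure lborel (L p \<inter> A)" if "A \<in> sets borel" for A
    using that K
    by (simp add: emeasure_density mult.assoc indicator_inter_arith[symmetric] nn_integral_cmult)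
  have e2: "emeasure ?M2 A = emeasure lborel (L q \<inter> A)" if "A \<in> sets borel" for A
    using that by (simp add: emeasure_density indicator_inter_arith[symmetric])
  have "finite_measure ?M1"
    using L pq by (intro finite_measureI) (auto simp: e1 ennreal_mult_eq_top_iff less_top)
  moreover have f2: "finite_measure ?M2"
    using L pq by (intro finite_measureI) (auto simp: e2 less_top)
  ultimately have s: "sigma_finite_measure ?M1" "sigma_finite_measure ?M2"
    by (auto simp: finite_measure_def)
  have "?M1 \<Otimes>\<^sub>M ?M2 = ?D"
  proof (rule pair_measure_eqI[OF s])
    have "sets (?M1 \<Otimes>\<^sub>M ?M2) = sets (lborel \<Otimes>\<^sub>M lborel :: (real \<times> real) measure)"
      by (intro sets_pair_measure_cong) auto
    then show "sets (?M1 \<Otimes>\<^sub>M ?M2) = sets ?D" by (simp only: lborel_prod) simp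
    fix A A' assume "A \<in> sets ?M1" "A' \<in> sets ?M2"
    then have A[measurable]: "A \<in> sets borel" "A' \<in> sets borel" by auto
    have AA: "A \<times> A' \<in> sets (lborel :: (real \<times> real) measure)"
      using A by (subst lborel_prod[symmetric]) auto
    \<comment> \<open>Within the box, the preimage of a rectangle is again a box, narrowed at
      \<open>p\<close> and \<open>q\<close>.\<close>
    define L' where "L' i = (if i = p then L p \<inter> A else if i = q then L q \<inter> A' else L i)" for i
    have L': "L' i \<in> sets borel" if "i \<in> I" for i
      using A L that by (auto simp: L'_def)
    have "emeasure ?D (A \<times> A') =
        emeasure (density P (indicator (Pi\<^sub>E I L))) ((\<lambda>x. (x p, x q)) -` (A \<times> A') \<inter> space P)"
      using m AA by (subst emeasure_distr) auto
    also have "\<dots> = emeasure P (Pi\<^sub>E I L \<inter> ((\<lambda>x. (x p, x q)) -` (A \<times> A') \<inter> space P))"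
      using sets_PiE_lborel[OF I L(1)] measurable_sets[OF m AA]
      by (simp add: emeasure_density P_def[symmetric] indicator_inter_arith[symmetric] Int_assoc)
    also have "Pi\<^sub>E I L \<inter> ((\<lambda>x. (x p, x q)) -` (A \<times> A') \<inter> space P) = Pi\<^sub>E I L'"
    proof (intro set_eqI iffI)
      fix x assume "x \<in> Pi\<^sub>E I L \<inter> ((\<lambda>x. (x p, x q)) -` (A \<times> A') \<inter> space P)"
      then show "x \<in> Pi\<^sub>E I L'" by (auto simp: L'_def PiE_iff)
    next
      fix x assume x: "x \<in> Pi\<^sub>E I L'"
      have "x i \<in> L i" if "i \<in> I" for i
        using PiE_mem[OF x that] by (auto simp: L'_def split: if_splits)
      moreover have "x p \<in> A" "x q \<in> A'"
        using PiE_mem[OF x pq(1)] PiE_mem[OF x pq(2)] pq(3) by (auto simp: L'_def)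
      ultimately show "x \<in> Pi\<^sub>E I L \<inter> ((\<lambda>x. (x p, x q)) -` (A \<times> A') \<inter> space P)"
        using x by (auto simp: P_def space_PiM PiE_iff)
    qed
    also have "emeasure P (Pi\<^sub>E I L') = (\<Prod>i\<in>I. emeasure lborel (L' i))"
      unfolding P_def by (rule emeasure_PiM_lborel[OF I L'])
    also have "\<dots> = emeasure lborel (L' p) * (emeasure lborel (L' q) * (\<Prod>i\<in>I - {p, q}. emeasure lborel (L' i)))"
    proof -
      have "I - {p} - {q} = I - {p, q}" by auto
      then show ?thesis
        using I pq by (subst prod.remove[of _ p], simp, simp, subst prod.remove[of _ q]) auto
    qed
    also have "(\<Prod>i\<in>I - {p, q}. emeasure lborel (L' i)) = (\<Prod>i\<in>I - {p, q}. ennreal (measure lborel (L i)))"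
      using L by (intro prod.cong refl) (auto simp: L'_def emeasure_eq_ennreal_measure less_top)
    also have "\<dots> = ennreal K"
      unfolding K_def by (rule prod_ennreal) auto
    finally show "emeasure ?M1 A * emeasure ?M2 A' = emeasure ?D (A \<times> A')"
      using pq by (simp add: e1 e2 L'_def mult_ac)
  qed
  moreover have "?M1 \<Otimes>\<^sub>M ?M2 = density (lborel \<Otimes>\<^sub>M lborel)
      (\<lambda>(x, y). ennreal K * indicator (L p) x * indicator (L q) y)"
    by (rule pair_measure_density) (use s in \<open>auto simp: sigma_finite_lborel\<close>)
  moreover have "(\<lambda>(x, y). ennreal K * indicator (L p) x * indicator (L q) y) =
      (\<lambda>z. ennreal (K * indicator (L p \<times> L q) z))"
    by (auto simp: fun_eq_iff indicator_def)
  ultimately show ?thesis by (simp add: lborel_prod K_def)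
qed

lemma integral_PiM_box_pair:
  fixes L :: "'i \<Rightarrow> real set" and f :: "real \<times> real \<Rightarrow> real"
  assumes I: "finite I" and pq: "p \<in> I" "q \<in> I" "p \<noteq> q"
    and L: "\<And>i. i \<in> I \<Longrightarrow> L i \<in> sets borel" "\<And>i. i \<in> I \<Longrightarrow> emeasure lborel (L i) < \<infinity>"
    and f: "f \<in> borel_measurable borel"
  shows "(LINT x|(\<Pi>\<^sub>M i\<in>I. lborel). indicator (Pi\<^sub>E I L) x * f (x p, x q)) =
    (\<Prod>i\<in>I - {p, q}. measure lborel (L i)) * (LINT z|lborel. indicator (L p \<times> L q) z * f z)"
proof -
  let ?P = "\<Pi>\<^sub>M i\<in>I. (lborel :: real measure)"
  define K where "K = (\<Prod>i\<in>I - {p, q}. measure lborel (L i))"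
  have K: "0 \<le> K" unfolding K_def by (intro prod_nonneg) auto
  have m: "(\<lambda>x. (x p, x q)) \<in> ?P \<rightarrow>\<^sub>M lborel"
    using measurable_pair_component[OF pq(1,2)] by simp
  have fm: "(\<lambda>x. f (x p, x q)) \<in> borel_measurable ?P"
    using measurable_compose[OF measurable_pair_component[OF pq(1,2)] f] .
  have LL: "L p \<times> L q \<in> sets borel"
    using L pq borel_Times by blast
  have "(LINT x|?P. indicator (Pi\<^sub>E I L) x * f (x p, x q)) =
      (LINT x|density ?P (\<lambda>x. ennreal (indicator (Pi\<^sub>E I L) x)). f (x p, x q))"
    using fm sets_PiE_lborel[OF I L(1)] by (subst integral_density) auto
  also have "\<dots> = (LINT x|density ?P (indicator (Pi\<^sub>E I L)). f (x p, x q))"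
    by (simp add: ennreal_indicator)
  also have "\<dots> = (LINT z|distr (density ?P (indicator (Pi\<^sub>E I L))) lborel (\<lambda>x. (x p, x q)). f z)"
    using m f by (subst integral_distr) auto
  also have "\<dots> = (LINT z|density lborel (\<lambda>z. ennreal (K * indicator (L p \<times> L q) z)). f z)"
    using distr_PiM_box_pair[OF I pq L] by (simp add: K_def)
  also have "\<dots> = (LINT z|lborel. K * indicator (L p \<times> L q) z * f z)"
    using K LL f by (subst integral_density) auto
  also have "\<dots> = K * (LINT z|lborel. indicator (L p \<times> L q) z * f z)"
    by (simp add: mult.assoc)
  finally show ?thesis by (simp add: K_def)
qed

text \<open>The marginal of the box on two coordinates has a density with respect to planar Lebesgue
  measure, so planar null sets pull back to null sets. This is how a Borel version replaces a
  graphon inside each edge factor.\<close>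

lemma AE_PiM_box_pair:
  fixes L :: "'i \<Rightarrow> real set"
  assumes I: "finite I" and pq: "p \<in> I" "q \<in> I" "p \<noteq> q"
    and L: "\<And>i. i \<in> I \<Longrightarrow> L i \<in> sets borel" "\<And>i. i \<in> I \<Longrightarrow> emeasure lborel (L i) < \<infinity>"
    and ae: "AE z in lborel. z \<in> L p \<times> L q \<longrightarrow> R z"
  shows "AE x in (\<Pi>\<^sub>M i\<in>I. lborel). x \<in> Pi\<^sub>E I L \<longrightarrow> R (x p, x q)"
proof -
  let ?P = "\<Pi>\<^sub>M i\<in>I. (lborel :: real measure)"
  have LL: "L p \<times> L q \<in> sets borel"
    using L pq borel_Times by blast
  define w where "w z = ennreal ((\<Prod>i\<in>I - {p, q}. measure lborel (L i)) * indicator (L p \<times> L q) z)" for z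
  have D: "distr (density ?P (indicator (Pi\<^sub>E I L))) lborel (\<lambda>x. (x p, x q)) = density lborel w"
    using distr_PiM_box_pair[OF I pq L] by (simp add: w_def[abs_def])
  have w: "w \<in> borel_measurable lborel"
    using LL by (simp add: w_def[abs_def])
  have pos: "z \<in> L p \<times> L q" if "0 < w z" for z
  proof (rule ccontr)
    assume "z \<notin> L p \<times> L q"
    then have "indicator (L p \<times> L q) z = (0 :: real)" by (rule indicator_simps(2))
    then show False using that by (simp add: w_def)
  qed
  have "AE z in lborel. 0 < w z \<longrightarrow> R z"
    using ae by eventually_elim (use pos in blast)
  then have "AE z in distr (density ?P (indicator (Pi\<^sub>E I L))) lborel (\<lambda>x. (x p, x q)). R z"
    unfolding D AE_density[OF w] .
  then have "AE x in density ?P (indicator (Pi\<^sub>E I L)). R (x p, x q)"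
    by (rule AE_distrD[rotated]) (use measurable_pair_component[OF pq(1,2)] in simp)
  then have "AE x in ?P. 0 < (indicator (Pi\<^sub>E I L) x :: ennreal) \<longrightarrow> R (x p, x q)"
    by (rule AE_density[THEN iffD1, rotated]) (use sets_PiE_lborel[OF I L(1)] in simp)
  then show ?thesis
    by (rule eventually_mono) simp
qed

lemma integrable_indicator_bounded:
  fixes f :: "'a \<Rightarrow> real"
  assumes "A \<in> sets M" "emeasure M A < \<infinity>" "f \<in> borel_measurable M" "\<And>x. x \<in> A \<Longrightarrow> \<bar>f x\<bar> \<le> K"
  shows "integrable M (\<lambda>x. indicator A x * f x)"
  using integrableI_bounded_set_indicator[OF assms(1,3,2), of K] assms(4) by simp

section \<open>The quadratic bound for block averages\<close>

context block_system
begin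

text \<open>For a solution \<open>C\<close> this is the objective at the block kernel (see
  \<open>objective_block\<close>), written as a finite sum so that the comparison is
  algebra.\<close>

definition block_value :: "(nat \<Rightarrow> nat \<Rightarrow> real) \<Rightarrow> real" where
  "block_value C =
     1/6 * (\<Sum>i<k. \<Sum>j<k. \<Sum>l<k. \<alpha> i j l * (C i j * C i l * C j l * (b i * b j * b l))) +
     1/2 * (\<Sum>i<k. \<Sum>j<k. h i j * (C i j * (b i * b j))) -
     1/2 * (\<Sum>i<k. \<Sum>j<k. neg_entropy (C i j) * (b i * b j))"

lemma rotate_indices:
  fixes f :: "nat \<Rightarrow> nat \<Rightarrow> nat \<Rightarrow> real"
  shows "(\<Sum>i<k. \<Sum>j<k. \<Sum>l<k. f i l j) = (\<Sum>i<k. \<Sum>j<k. \<Sum>l<k. f i j l)"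
    and "(\<Sum>i<k. \<Sum>j<k. \<Sum>l<k. f j l i) = (\<Sum>i<k. \<Sum>j<k. \<Sum>l<k. f i j l)"
proof -
  show 1: "(\<Sum>i<k. \<Sum>j<k. \<Sum>l<k. f i l j) = (\<Sum>i<k. \<Sum>j<k. \<Sum>l<k. f i j l)" for f :: "nat \<Rightarrow> nat \<Rightarrow> nat \<Rightarrow> real"
    by (intro sum.cong refl sum.swap)
  have "(\<Sum>i<k. \<Sum>j<k. \<Sum>l<k. f j l i) = (\<Sum>j<k. \<Sum>i<k. \<Sum>l<k. f j l i)"
    by (rule sum.swap)
  also have "\<dots> = (\<Sum>i<k. \<Sum>j<k. \<Sum>l<k. f i j l)"
    by (rule 1)
  finally show "(\<Sum>i<k. \<Sum>j<k. \<Sum>l<k. f j l i) = (\<Sum>i<k. \<Sum>j<k. \<Sum>l<k. f i j l)" .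
qed

text \<open>By the symmetry of \<alpha>, renaming indices makes the contributions of the three edges
  equal, and the sum over \<open>l\<close> reassembles the \<alpha>-part of \<open>field\<close>.
  The factor 3 turns the prefactor 1/6 of the triangles into the 1/2 of the other two terms.\<close>

lemma sum_first_variation:
  assumes C: "\<And>i j. i < k \<Longrightarrow> j < k \<Longrightarrow> C i j = C j i"
  shows "(\<Sum>i<k. \<Sum>j<k. \<Sum>l<k. \<alpha> i j l *
      (C i l * C j l * (b l * W i j) + C i j * C j l * (b j * W i l) + C i j * C i l * (b i * W j l))) =
    3 * (\<Sum>i<k. \<Sum>j<k. (field C i j - h i j) * W i j)"
proof -
  define f where "f i j l = \<alpha> i j l * (C i l * C j l * (b l * W i j))" for i j l
  have perm: "\<alpha> i l j = \<alpha> i j l" "\<alpha> j l i = \<alpha> i j l" if "i < k" "j < k" "l < k" for i j l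
    using that \<alpha>_swap \<alpha>_rot by metis+
  have "(\<Sum>i<k. \<Sum>j<k. \<Sum>l<k. \<alpha> i j l *
      (C i l * C j l * (b l * W i j) + C i j * C j l * (b j * W i l) + C i j * C i l * (b i * W j l))) =
    (\<Sum>i<k. \<Sum>j<k. \<Sum>l<k. f i j l + f i l j + f j l i)"
  proof (intro sum.cong refl)
    fix i j l assume "i \<in> {..<k}" "j \<in> {..<k}" "l \<in> {..<k}"
    then have ijl: "i < k" "j < k" "l < k" by auto
    show "\<alpha> i j l *
      (C i l * C j l * (b l * W i j) + C i j * C j l * (b j * W i l) + C i j * C i l * (b i * W j l)) =
      f i j l + f i l j + f j l i"
      unfolding f_def perm(1)[OF ijl] perm(2)[OF ijl] C[OF ijl(3,2)] C[OF ijl(2,1)] C[OF ijl(3,1)]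
      by (simp only: distrib_left)
  qed
  also have "\<dots> = 3 * (\<Sum>i<k. \<Sum>j<k. \<Sum>l<k. f i j l)"
    by (simp add: sum.distrib rotate_indices[of f])
  also have "(\<Sum>i<k. \<Sum>j<k. \<Sum>l<k. f i j l) = (\<Sum>i<k. \<Sum>j<k. (field C i j - h i j) * W i j)"
    by (intro sum.cong refl) (simp add: f_def field_def sum_distrib_left sum_distrib_right mult_ac)
  finally show ?thesis .
qed

text \<open>The same renaming as in \<open>sum_first_variation\<close>; what remains of the third
  index is the total weight 1.\<close>

lemma sum_second_variation:
  "(\<Sum>i<k. \<Sum>j<k. \<Sum>l<k. b l * Q i j + b j * Q i l + b i * Q j l) = 3 * (\<Sum>i<k. \<Sum>j<k. Q i j)"
proof -
  define f where "f i j l = b l * Q i j" for i j l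
  have "(\<Sum>i<k. \<Sum>j<k. \<Sum>l<k. b l * Q i j + b j * Q i l + b i * Q j l) =
      (\<Sum>i<k. \<Sum>j<k. \<Sum>l<k. f i j l + f i l j + f j l i)"
    by (simp add: f_def)
  also have "\<dots> = 3 * (\<Sum>i<k. \<Sum>j<k. \<Sum>l<k. f i j l)"
    by (simp add: sum.distrib rotate_indices[of f])
  also have "(\<Sum>i<k. \<Sum>j<k. \<Sum>l<k. f i j l) = (\<Sum>i<k. \<Sum>j<k. Q i j)"
    by (simp add: f_def sum_distrib_right[symmetric] b_sum)
  finally show ?thesis .
qed

text \<open>The algebraic core, free of integrals: \<open>T\<close>, \<open>E\<close> and
  \<open>S\<close> stand for the triangle densities, edge densities and entropies of an arbitrary
  graphon, \<open>W\<close> and \<open>Q\<close> for the first and second moments of its deviation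
  from \<open>C\<close> on the blocks. The triangles contribute \<open>field - h\<close> to the
  coefficient of \<open>W\<close>, the edges \<open>h\<close> and the entropy
  \<open>- field\<close>, so nothing is left of first order.\<close>

lemma block_value_bound:
  assumes C: "solves_system k b \<alpha> h C"
    and Q: "\<And>i j. i < k \<Longrightarrow> j < k \<Longrightarrow> 0 \<le> Q i j"
    and T: "\<And>i j l. i < k \<Longrightarrow> j < k \<Longrightarrow> l < k \<Longrightarrow>
      \<bar>T i j l - (C i j * C i l * C j l * (b i * b j * b l) +
        (C i l * C j l * (b l * W i j) + C i j * C j l * (b j * W i l) + C i j * C i l * (b i * W j l)))\<bar>
      \<le> b l * Q i j + b j * Q i l + b i * Q j l"
    and E: "\<And>i j. i < k \<Longrightarrow> j < k \<Longrightarrow> E i j = C i j * (b i * b j) + W i j"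
    and S: "\<And>i j. i < k \<Longrightarrow> j < k \<Longrightarrow>
      neg_entropy (C i j) * (b i * b j) + (ln (C i j) - ln (1 - C i j)) * W i j + 2 * Q i j \<le> S i j"
  shows "1/6 * (\<Sum>i<k. \<Sum>j<k. \<Sum>l<k. \<alpha> i j l * T i j l) + 1/2 * (\<Sum>i<k. \<Sum>j<k. h i j * E i j) -
    1/2 * (\<Sum>i<k. \<Sum>j<k. S i j) \<le> block_value C - (1 - A / 2) * (\<Sum>i<k. \<Sum>j<k. Q i j)"
proof -
  have Csym: "C i j = C j i" and Cfix: "C i j = logistic (field C i j)" if "i < k" "j < k" for i j
    using C that by (auto simp: solves_system_iff)
  let ?V = "\<lambda>i j l. C i l * C j l * (b l * W i j) + C i j * C j l * (b j * W i l) + C i j * C i l * (b i * W j l)"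
  let ?Z = "\<lambda>i j l. C i j * C i l * C j l * (b i * b j * b l)"
  let ?R = "\<lambda>i j l. b l * Q i j + b j * Q i l + b i * Q j l"
  have "(\<Sum>i<k. \<Sum>j<k. \<Sum>l<k. \<alpha> i j l * T i j l) \<le>
      (\<Sum>i<k. \<Sum>j<k. \<Sum>l<k. \<alpha> i j l * ?Z i j l + \<alpha> i j l * ?V i j l + A * ?R i j l)"
  proof (intro sum_mono)
    fix i j l assume "i \<in> {..<k}" "j \<in> {..<k}" "l \<in> {..<k}"
    then have ijl: "i < k" "j < k" "l < k" by auto
    have "\<alpha> i j l * (T i j l - (?Z i j l + ?V i j l)) \<le> \<bar>\<alpha> i j l\<bar> * \<bar>T i j l - (?Z i j l + ?V i j l)\<bar>"
      using abs_ge_self[of "\<alpha> i j l * (T i j l - (?Z i j l + ?V i j l))"] by (simp only: abs_mult)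
    also have "\<dots> \<le> A * ?R i j l"
      using \<alpha>_le[OF ijl] T[OF ijl] A_nonneg by (intro mult_mono) auto
    finally show "\<alpha> i j l * T i j l \<le> \<alpha> i j l * ?Z i j l + \<alpha> i j l * ?V i j l + A * ?R i j l"
      by (simp only: right_diff_distrib distrib_left[of "\<alpha> i j l" "?Z i j l" "?V i j l"])
  qed
  also have "\<dots> = (\<Sum>i<k. \<Sum>j<k. \<Sum>l<k. \<alpha> i j l * ?Z i j l) + (\<Sum>i<k. \<Sum>j<k. \<Sum>l<k. \<alpha> i j l * ?V i j l) +
      A * (\<Sum>i<k. \<Sum>j<k. \<Sum>l<k. ?R i j l)"
  proof -
    have "(\<Sum>i<k. \<Sum>j<k. \<Sum>l<k. x i j l + y i j l + A * z i j l) = (\<Sum>i<k. \<Sum>j<k. \<Sum>l<k. x i j l) +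
        (\<Sum>i<k. \<Sum>j<k. \<Sum>l<k. y i j l) + A * (\<Sum>i<k. \<Sum>j<k. \<Sum>l<k. z i j l)"
      for x y z :: "nat \<Rightarrow> nat \<Rightarrow> nat \<Rightarrow> real"
      by (simp add: sum.distrib sum_distrib_left)
    then show ?thesis .
  qed
  also have "\<dots> = (\<Sum>i<k. \<Sum>j<k. \<Sum>l<k. \<alpha> i j l * ?Z i j l) +
      3 * (\<Sum>i<k. \<Sum>j<k. (field C i j - h i j) * W i j) + A * (3 * (\<Sum>i<k. \<Sum>j<k. Q i j))"
    by (simp only: sum_first_variation[OF Csym] sum_second_variation)
  also have "(\<Sum>i<k. \<Sum>j<k. (field C i j - h i j) * W i j) =
      (\<Sum>i<k. \<Sum>j<k. field C i j * W i j) - (\<Sum>i<k. \<Sum>j<k. h i j * W i j)"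
    by (simp only: left_diff_distrib sum_subtractf)
  finally have 1: "(\<Sum>i<k. \<Sum>j<k. \<Sum>l<k. \<alpha> i j l * T i j l) \<le>
      (\<Sum>i<k. \<Sum>j<k. \<Sum>l<k. \<alpha> i j l * ?Z i j l) +
      3 * ((\<Sum>i<k. \<Sum>j<k. field C i j * W i j) - (\<Sum>i<k. \<Sum>j<k. h i j * W i j)) +
      A * (3 * (\<Sum>i<k. \<Sum>j<k. Q i j))" .
  have 2: "(\<Sum>i<k. \<Sum>j<k. h i j * E i j) =
      (\<Sum>i<k. \<Sum>j<k. h i j * (C i j * (b i * b j))) + (\<Sum>i<k. \<Sum>j<k. h i j * W i j)"
    by (simp add: E distrib_left sum.distrib)
  have "(\<Sum>i<k. \<Sum>j<k. neg_entropy (C i j) * (b i * b j) + field C i j * W i j + 2 * Q i j) \<le>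
      (\<Sum>i<k. \<Sum>j<k. S i j)"
  proof (intro sum_mono)
    fix i j assume "i \<in> {..<k}" "j \<in> {..<k}"
    then have ij: "i < k" "j < k" by auto
    show "neg_entropy (C i j) * (b i * b j) + field C i j * W i j + 2 * Q i j \<le> S i j"
      using S[OF ij] ln_logistic[of "field C i j"] by (simp add: Cfix[OF ij, symmetric])
  qed
  then have 3: "(\<Sum>i<k. \<Sum>j<k. neg_entropy (C i j) * (b i * b j)) + (\<Sum>i<k. \<Sum>j<k. field C i j * W i j) +
      2 * (\<Sum>i<k. \<Sum>j<k. Q i j) \<le> (\<Sum>i<k. \<Sum>j<k. S i j)"
    by (simp only: sum.distrib sum_distrib_left)
  have 4: "(1 - A / 2) * (\<Sum>i<k. \<Sum>j<k. Q i j) = (\<Sum>i<k. \<Sum>j<k. Q i j) - A * (3 * (\<Sum>i<k. \<Sum>j<k. Q i j)) / 6"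
    by (simp add: algebra_simps)
  \<comment> \<open>With the sums abstracted to real variables, the cancellation of the first-order
    terms \<open>f\<close> and \<open>w\<close> is linear arithmetic.\<close>
  have "1/6 * t + 1/2 * e - 1/2 * s \<le> 1/6 * z + 1/2 * c - 1/2 * n - (q - a / 6)"
    if "t \<le> z + 3 * (f - w) + a" "e = c + w" "n + f + 2 * q \<le> s" for t z f w a e c n q s :: real
    using that by (simp add: field_simps)
  from this[OF 1 2 3] show ?thesis
    unfolding block_value_def 4 .
qed

end

section \<open>Graphons and subgraph densities\<close>

abbreviation (input) unit_square :: "(real \<times> real) set" where
  "unit_square \<equiv> {0..1} \<times> {0..1}"

lemma unit_square_borel: "unit_square \<in> sets borel"
  by (intro borel_Times) auto

text \<open>Borel measurability on the whole plane allows composition with coordinate pairs of a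
  product space. The bounds are demanded everywhere, so that integrability needs no case distinction
  at the border of the square.\<close>

definition borel_version :: "kernel \<Rightarrow> kernel \<Rightarrow> bool" where
  "borel_version g g' \<longleftrightarrow> g' \<in> borel_measurable borel \<and> (\<forall>z. g' z \<in> {0..1}) \<and>
     (AE z in lborel. z \<in> unit_square \<longrightarrow> g z = g' z)"

lemma graphon_borel_version:
  assumes "g \<in> graphons"
  obtains g' where "borel_version g g'"
proof -
  have "(\<lambda>z. if z \<in> unit_square then g z else 0) \<in> borel_measurable lebesgue"
    using assms unit_square_borel by (subst borel_measurable_if) (auto simp: graphons_def)
  then obtain f where f: "f \<in> borel_measurable lborel"
      "AE z in lborel. (if z \<in> unit_square then g z else 0) = f z"
    using completion_ex_borel_measurable_real by blast
  have g01: "0 \<le> g z \<and> g z \<le> 1" if "z \<in> unit_square" for z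
    using assms that by (cases z) (auto simp: graphons_def)
  show ?thesis
  \<comment> \<open>Clipping enforces the bounds everywhere and keeps the agreement, because
    \<open>g\<close> itself stays in the unit interval on the square.\<close>
  proof (rule that[of "\<lambda>z. max 0 (min 1 (f z))"])
    have "AE z in lborel. z \<in> unit_square \<longrightarrow> g z = max 0 (min 1 (f z))"
      using f(2)
    proof eventually_elim
      case (elim z)
      show ?case
      proof
        assume "z \<in> unit_square"
        then show "g z = max 0 (min 1 (f z))" using elim g01[of z] by simp
      qed
    qed
    then show "borel_version g (\<lambda>z. max 0 (min 1 (f z)))"
      using f(1) by (auto simp: borel_version_def)
  qed
qed

lemma neg_entropy_measurable[measurable]: "neg_entropy \<in> borel_measurable borel"
  unfolding neg_entropy_def[abs_def] by measurable

text \<open>Both summands are nonpositive, and the tangent at 1/2 is horizontal with value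
  \<open>- ln 2\<close>, which bounds the function from below.\<close>

lemma neg_entropy_abs_le:
  assumes "u \<in> {0..1}"
  shows "\<bar>neg_entropy u\<bar> \<le> ln 2"
proof -
  have le: "v * ln v \<le> 0" if "v \<in> {0..1}" for v :: real
    using that by (cases "v = 0") (auto intro!: mult_nonneg_nonpos simp: ln_le_zero_iff)
  have "u * ln u \<le> 0" "(1 - u) * ln (1 - u) \<le> 0"
    using le[of u] le[of "1 - u"] assms by auto
  moreover have "neg_entropy (1 / 2) = - ln 2"
    by (simp add: neg_entropy_def ln_div)
  moreover have "neg_entropy (1/2) + (ln (1/2) - ln (1 - 1/2)) * (u - 1/2) + 2 * (u - 1/2)\<^sup>2 \<le> neg_entropy u"
    using assms by (intro neg_entropy_tangent_bound) auto
  moreover have "neg_entropy (1/2) \<le> neg_entropy (1/2) + (ln (1/2) - ln (1 - 1/2)) * (u - 1/2) + 2 * (u - 1/2)\<^sup>2"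
    by simp
  moreover have "(0::real) \<le> ln 2" by simp
  ultimately show ?thesis
    unfolding neg_entropy_def by linarith
qed

section \<open>Integrals and densities over colour classes\<close>

locale colored_system = block_system +
  fixes B :: "nat \<Rightarrow> real set"
  assumes B: "color_partition k b B"
begin

lemma B_borel: "i < k \<Longrightarrow> B i \<in> sets borel"
  using B by (intro real_interval_borel_measurable) (auto simp: color_partition_def)

lemma B_subset: "i < k \<Longrightarrow> B i \<subseteq> {0..1}"
  using B by (auto simp: color_partition_def)

lemma B_measure: "i < k \<Longrightarrow> measure lborel (B i) = b i"
  using B B_borel[of i] by (auto simp: color_partition_def)

lemma B_emeasure: "i < k \<Longrightarrow> emeasure lborel (B i) < \<infinity>"
  using emeasure_mono[OF B_subset, of i lborel] by (auto intro: le_less_trans)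

lemma B_Times_borel: "i < k \<Longrightarrow> j < k \<Longrightarrow> B i \<times> B j \<in> sets borel"
  using B_borel borel_Times by blast

lemma B_Times_subset: "i < k \<Longrightarrow> j < k \<Longrightarrow> B i \<times> B j \<subseteq> unit_square"
  using B_subset by blast

lemma B_Times_emeasure:
  assumes "i < k" "j < k"
  shows "emeasure lborel (B i \<times> B j) = ennreal (b i * b j)"
proof -
  have "emeasure lborel (B i \<times> B j) = emeasure (lborel \<Otimes>\<^sub>M lborel) (B i \<times> B j)"
    by (simp add: lborel_prod)
  also have "\<dots> = emeasure lborel (B i) * emeasure lborel (B j)"
    using B_borel assms by (intro lborel.emeasure_pair_measure_Times) auto
  also have "\<dots> = ennreal (b i * b j)"
    using assms B_emeasure B_measure b_pos
    by (simp add: emeasure_eq_ennreal_measure less_top ennreal_mult less_imp_le)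
  finally show ?thesis .
qed

lemma integral_B_Times_const:
  assumes "i < k" "j < k"
  shows "(LINT z|lborel. indicator (B i \<times> B j) z * c) = c * (b i * b j)"
  using assms B_Times_borel[OF assms] b_pos
  by (simp add: measure_def B_Times_emeasure less_imp_le mult.commute)

lemma integrable_B_Times:
  fixes f :: "real \<times> real \<Rightarrow> real"
  assumes "i < k" "j < k" "f \<in> borel_measurable borel" "\<And>z. \<bar>f z\<bar> \<le> K"
  shows "integrable lborel (\<lambda>z. indicator (B i \<times> B j) z * f z)"
  using assms B_Times_borel by (intro integrable_indicator_bounded[where K=K]) (auto simp: B_Times_emeasure)

lemma LINT_B_Times_borel_version:
  fixes \<phi> :: "real \<Rightarrow> real"
  assumes g': "borel_version g g'" and ij: "i < k" "j < k" and \<phi>: "\<phi> \<in> borel_measurable borel"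
  shows "(LINT z:B i \<times> B j|lebesgue. \<phi> (g z)) = (LINT z|lborel. indicator (B i \<times> B j) z * \<phi> (g' z))"
  unfolding set_lebesgue_integral_def
proof (rule integral_completion_AE_eq)
  show "(\<lambda>z. indicator (B i \<times> B j) z * \<phi> (g' z)) \<in> borel_measurable lborel"
    using B_Times_borel[OF ij] g' \<phi> by (auto simp: borel_version_def intro!: measurable_compose[OF _ \<phi>])
  have "AE z in lborel. z \<in> unit_square \<longrightarrow> g z = g' z"
    using g' by (simp add: borel_version_def)
  then show "AE z in lborel. indicator (B i \<times> B j) z *\<^sub>R \<phi> (g z) = indicator (B i \<times> B j) z * \<phi> (g' z)"
    by eventually_elim (use B_Times_subset[OF ij] in \<open>auto simp: indicator_def\<close>)
qed

lemma density_box_integrable: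
  fixes L :: "nat \<Rightarrow> nat" and f :: "(nat \<Rightarrow> real) \<Rightarrow> real"
  assumes L: "\<And>p. p < n \<Longrightarrow> L p < k" and f: "f \<in> borel_measurable (\<Pi>\<^sub>M p\<in>{..<n}. (lborel :: real measure))"
    and K: "\<And>x. \<bar>f x\<bar> \<le> K"
  shows "integrable (\<Pi>\<^sub>M p\<in>{..<n}. lborel) (\<lambda>x. indicator (\<Pi>\<^sub>E p\<in>{..<n}. B (L p)) x * f x)"
proof (rule integrable_indicator_bounded[where K = K])
  show "(\<Pi>\<^sub>E p\<in>{..<n}. B (L p)) \<in> sets (\<Pi>\<^sub>M p\<in>{..<n}. lborel)"
    using L B_borel by (intro sets_PiE_lborel) auto
  have "emeasure (\<Pi>\<^sub>M p\<in>{..<n}. lborel) (\<Pi>\<^sub>E p\<in>{..<n}. B (L p)) = (\<Prod>p<n. emeasure lborel (B (L p)))"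
    using L B_borel by (intro emeasure_PiM_lborel) auto
  also have "\<dots> = (\<Prod>p<n. ennreal (b (L p)))"
    using L B_emeasure B_measure by (intro prod.cong refl) (auto simp: emeasure_eq_ennreal_measure less_top)
  also have "\<dots> < \<infinity>"
    using L b_pos by (subst prod_ennreal) (auto simp: less_imp_le)
  finally show "emeasure (\<Pi>\<^sub>M p\<in>{..<n}. lborel) (\<Pi>\<^sub>E p\<in>{..<n}. B (L p)) < \<infinity>" .
qed (use f K in auto)

text \<open>Each edge factor agrees with its Borel version outside a null set pulled back from the
  plane, and three such exceptional sets are still null.\<close>

lemma triangle_density_eq:
  assumes g': "borel_version g g'" and ijl: "i < k" "j < k" "l < k"
  defines "P \<equiv> \<Pi>\<^sub>M p\<in>{..<3::nat}. (lborel :: real measure)"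
  shows "colored_density B [i, j, l] triangle_graph g =
    (LINT x|P. indicator (\<Pi>\<^sub>E p\<in>{..<3}. B ([i, j, l] ! p)) x * (g' (x 0, x 1) * g' (x 0, x 2) * g' (x 1, x 2)))"
proof -
  let ?L = "\<lambda>p. B ([i, j, l] ! p)"
  have L: "[i, j, l] ! p < k" if "p < 3" for p
    using that ijl by (auto simp: less_Suc_eq numeral_3_eq_3)
  \<comment> \<open>The product runs over a set of edges, so its splitting relies on the three edges
    being distinct.\<close>
  have prod: "(\<Prod>e\<in>triangle_graph. f e) = f {0, 1} * f {0, 2} * f {1, 2}" for f :: "nat set \<Rightarrow> real"
    by (simp add: triangle_graph_def doubleton_eq_iff mult.assoc)
  have eq: "(\<Prod>e\<in>triangle_graph. g (x (Min e), x (Max e))) = g (x 0, x 1) * g (x 0, x 2) * g (x 1, x 2)"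
    for x :: "nat \<Rightarrow> real"
    unfolding prod by (simp add: numeral_2_eq_2)
  have len: "{..<length [i, j, l]} = {..<3}" by auto
  have g'm: "g' \<in> borel_measurable borel" using g' by (simp add: borel_version_def)
  have "colored_density B [i, j, l] triangle_graph g =
      (LINT x|completion P. indicator (Pi\<^sub>E {..<3} ?L) x * (g (x 0, x 1) * g (x 0, x 2) * g (x 1, x 2)))"
    unfolding colored_density_def set_lebesgue_integral_def eq len P_def by simp
  also have "\<dots> = (LINT x|P. indicator (Pi\<^sub>E {..<3} ?L) x * (g' (x 0, x 1) * g' (x 0, x 2) * g' (x 1, x 2)))"
  proof (rule integral_completion_AE_eq)
    have "(\<lambda>x. g' (x p, x q)) \<in> borel_measurable P" if "p < 3" "q < 3" for p q
      unfolding P_def using that by (intro measurable_compose[OF measurable_pair_component g'm]) auto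
    then show "(\<lambda>x. indicator (Pi\<^sub>E {..<3} ?L) x * (g' (x 0, x 1) * g' (x 0, x 2) * g' (x 1, x 2))) \<in> borel_measurable P"
      using sets_PiE_lborel[of "{..<3::nat}" ?L] L B_borel
      by (intro borel_measurable_times borel_measurable_indicator) (auto simp: P_def)
    have ae: "AE x in P. x \<in> Pi\<^sub>E {..<3} ?L \<longrightarrow> g (x p, x q) = g' (x p, x q)" if "p < 3" "q < 3" "p \<noteq> q" for p q
      unfolding P_def
    proof (rule AE_PiM_box_pair[where R = "\<lambda>z. g z = g' z"])
      have "AE z in lborel. z \<in> unit_square \<longrightarrow> g z = g' z"
        using g' by (simp add: borel_version_def)
      then show "AE z in lborel. z \<in> ?L p \<times> ?L q \<longrightarrow> g z = g' z"
        by eventually_elim (use B_Times_subset[OF L[OF that(1)] L[OF that(2)]] in blast)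
    qed (use that L B_borel B_emeasure in auto)
    have "AE x in P. x \<in> Pi\<^sub>E {..<3} ?L \<longrightarrow> g (x 0, x 1) = g' (x 0, x 1)"
      "AE x in P. x \<in> Pi\<^sub>E {..<3} ?L \<longrightarrow> g (x 0, x 2) = g' (x 0, x 2)"
      "AE x in P. x \<in> Pi\<^sub>E {..<3} ?L \<longrightarrow> g (x 1, x 2) = g' (x 1, x 2)"
      by (rule ae; simp)+
    then show "AE x in P. indicator (Pi\<^sub>E {..<3} ?L) x * (g (x 0, x 1) * g (x 0, x 2) * g (x 1, x 2)) =
        indicator (Pi\<^sub>E {..<3} ?L) x * (g' (x 0, x 1) * g' (x 0, x 2) * g' (x 1, x 2))"
      by eventually_elim (auto simp: indicator_def)
  qed
  finally show ?thesis .
qed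

lemma edge_density_eq:
  assumes g': "borel_version g g'" and ij: "i < k" "j < k"
  shows "colored_density B [i, j] edge_graph g = (LINT z|lborel. indicator (B i \<times> B j) z * g' z)"
proof -
  let ?P = "\<Pi>\<^sub>M p\<in>{..<2::nat}. (lborel :: real measure)"
  let ?L = "\<lambda>p. B ([i, j] ! p)"
  have L: "[i, j] ! p < k" if "p < 2" for p
    using that ij by (auto simp: less_Suc_eq numeral_2_eq_2)
  have eq: "(\<Prod>e\<in>edge_graph. g (x (Min e), x (Max e))) = g (x 0, x 1)" for x :: "nat \<Rightarrow> real"
    by (simp add: edge_graph_def)
  have len: "{..<length [i, j]} = {..<2}" by auto
  have g'm: "g' \<in> borel_measurable borel" using g' by (simp add: borel_version_def)
  have "colored_density B [i, j] edge_graph g =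
      (LINT x|completion ?P. indicator (Pi\<^sub>E {..<2} ?L) x * g (x 0, x 1))"
    unfolding colored_density_def set_lebesgue_integral_def eq len by simp
  also have "\<dots> = (LINT x|?P. indicator (Pi\<^sub>E {..<2} ?L) x * g' (x 0, x 1))"
  proof (rule integral_completion_AE_eq)
    have "(\<lambda>x. g' (x 0, x 1)) \<in> borel_measurable ?P"
      by (intro measurable_compose[OF measurable_pair_component g'm]) auto
    then show "(\<lambda>x. indicator (Pi\<^sub>E {..<2} ?L) x * g' (x 0, x 1)) \<in> borel_measurable ?P"
      using sets_PiE_lborel[of "{..<2::nat}" ?L] L B_borel
      by (intro borel_measurable_times borel_measurable_indicator) auto
    have "AE x in ?P. x \<in> Pi\<^sub>E {..<2} ?L \<longrightarrow> g (x 0, x 1) = g' (x 0, x 1)"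
    proof (rule AE_PiM_box_pair[where R = "\<lambda>z. g z = g' z"])
      have "AE z in lborel. z \<in> unit_square \<longrightarrow> g z = g' z"
        using g' by (simp add: borel_version_def)
      then show "AE z in lborel. z \<in> ?L 0 \<times> ?L 1 \<longrightarrow> g z = g' z"
        by eventually_elim (use B_Times_subset[OF ij] in auto)
    qed (use L B_borel B_emeasure in auto)
    then show "AE x in ?P. indicator (Pi\<^sub>E {..<2} ?L) x * g (x 0, x 1) =
        indicator (Pi\<^sub>E {..<2} ?L) x * g' (x 0, x 1)"
      by eventually_elim (auto simp: indicator_def)
  qed
  also have "\<dots> = (\<Prod>r\<in>{..<2} - {0, 1}. measure lborel (?L r)) * (LINT z|lborel. indicator (?L 0 \<times> ?L 1) z * g' z)"
    using L B_borel B_emeasure g'm by (intro integral_PiM_box_pair) auto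
  \<comment> \<open>No coordinate is left to integrate out, so the constant of the marginal is an
    empty product.\<close>
  also have "{..<2} - {0, 1} = ({} :: nat set)" by auto
  finally show ?thesis by simp
qed

end

section \<open>The objective compared with its block value\<close>

context colored_system
begin

text \<open>\<open>triple_product_expansion\<close>, integrated over the box of three colours. Each
  linear or squared term involves two coordinates, and integrating out the third yields the factor
  \<open>b l\<close>, \<open>b j\<close> or \<open>b i\<close>.\<close>

lemma triangle_density_bound:
  assumes g': "borel_version g g'" and ijl: "i < k" "j < k" "l < k"
    and C: "\<And>i j. i < k \<Longrightarrow> j < k \<Longrightarrow> C i j \<in> {0..1}"
  defines "W \<equiv> \<lambda>i j. LINT z|lborel. indicator (B i \<times> B j) z * (g' z - C i j)"
    and "Q \<equiv> \<lambda>i j. LINT z|lborel. indicator (B i \<times> B j) z * (g' z - C i j)\<^sup>2"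
  shows "\<bar>colored_density B [i, j, l] triangle_graph g - (C i j * C i l * C j l * (b i * b j * b l) +
        (C i l * C j l * (b l * W i j) + C i j * C j l * (b j * W i l) + C i j * C i l * (b i * W j l)))\<bar>
      \<le> b l * Q i j + b j * Q i l + b i * Q j l"
proof -
  define P where "P = (\<Pi>\<^sub>M p\<in>{..<3::nat}. (lborel :: real measure))"
  define I :: "(nat \<Rightarrow> real) \<Rightarrow> real" where "I = indicator (\<Pi>\<^sub>E p\<in>{..<3}. B ([i, j, l] ! p))"
  define t where "t x = g' (x 0, x 1) * g' (x 0, x 2) * g' (x 1, x 2)" for x :: "nat \<Rightarrow> real"
  define u where "u c p q x = g' (x p, x q) - c" for c p q and x :: "nat \<Rightarrow> real"
  have L: "[i, j, l] ! p < k" if "p < 3" for p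
    using that ijl by (auto simp: less_Suc_eq numeral_3_eq_3)
  have g'm[measurable]: "g' \<in> borel_measurable borel" and g'01: "\<And>z. g' z \<in> {0..1}"
    using g' by (auto simp: borel_version_def)
  have comp: "(\<lambda>x. g' (x p, x q)) \<in> borel_measurable P" if "p < 3" "q < 3" for p q
    unfolding P_def using that by (intro measurable_compose[OF measurable_pair_component g'm]) auto
  have u_m: "u c p q \<in> borel_measurable P" if "p < 3" "q < 3" for c p q
    unfolding u_def[abs_def] using comp[OF that] by measurable
  have t_m: "t \<in> borel_measurable P"
    unfolding t_def[abs_def] by (intro borel_measurable_times comp) auto
  have u_le: "\<bar>u c p q x\<bar> \<le> 1" if "c \<in> {0..1}" for c p q x
    using g'01[of "(x p, x q)"] that by (auto simp: u_def)
  have t_le: "\<bar>t x\<bar> \<le> 1" for x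
    unfolding t_def abs_mult using g'01 by (intro mult_le_one) (auto intro!: mult_le_one)
  have int_t: "integrable P (\<lambda>x. I x * t x)"
    using t_m t_le unfolding P_def I_def by (intro density_box_integrable[OF L]) auto
  have int_1: "integrable P (\<lambda>x. I x * c)" for c
    unfolding P_def I_def by (intro density_box_integrable[OF L, where K = "\<bar>c\<bar>"]) auto
  have int_u: "integrable P (\<lambda>x. I x * u c p q x)" if "p < 3" "q < 3" "c \<in> {0..1}" for c p q
    using u_m[OF that(1,2)] u_le[OF that(3)] unfolding P_def I_def
    by (intro density_box_integrable[OF L, where K = 1]) auto
  have int_u2: "integrable P (\<lambda>x. I x * (u c p q x)\<^sup>2)" if "p < 3" "q < 3" "c \<in> {0..1}" for c p q
    using u_m[OF that(1,2)] u_le[OF that(3)] unfolding P_def I_def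
    by (intro density_box_integrable[OF L, where K = 1]) (auto simp: abs_square_le_1)
  have marginal: "(LINT x|P. I x * f (x p, x q)) =
      (\<Prod>r\<in>{..<3} - {p, q}. b ([i, j, l] ! r)) *
      (LINT z|lborel. indicator (B ([i, j, l] ! p) \<times> B ([i, j, l] ! q)) z * f z)"
    if "p < 3" "q < 3" "p \<noteq> q" "f \<in> borel_measurable borel" for p q and f :: "real \<times> real \<Rightarrow> real"
  proof -
    have "(LINT x|P. I x * f (x p, x q)) =
      (\<Prod>r\<in>{..<3} - {p, q}. measure lborel (B ([i, j, l] ! r))) *
      (LINT z|lborel. indicator (B ([i, j, l] ! p) \<times> B ([i, j, l] ! q)) z * f z)"
      unfolding P_def I_def using that L B_borel B_emeasure by (intro integral_PiM_box_pair) auto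
    also have "(\<Prod>r\<in>{..<3} - {p, q}. measure lborel (B ([i, j, l] ! r))) = (\<Prod>r\<in>{..<3} - {p, q}. b ([i, j, l] ! r))"
      using L B_measure by (intro prod.cong) auto
    finally show ?thesis .
  qed
  have rest: "{..<3} - {0, 1} = {2::nat}" "{..<3} - {0, 2} = {1::nat}" "{..<3} - {1, 2} = {0::nat}"
    by auto
  have m01: "(LINT x|P. I x * f (x 0, x 1)) = b l * (LINT z|lborel. indicator (B i \<times> B j) z * f z)"
    and m02: "(LINT x|P. I x * f (x 0, x 2)) = b j * (LINT z|lborel. indicator (B i \<times> B l) z * f z)"
    and m12: "(LINT x|P. I x * f (x 1, x 2)) = b i * (LINT z|lborel. indicator (B j \<times> B l) z * f z)"
    if "f \<in> borel_measurable borel" for f :: "real \<times> real \<Rightarrow> real"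
    using marginal[of 0 1 f] marginal[of 0 2 f] marginal[of 1 2 f] that
    unfolding rest by simp_all
  have J1: "(LINT x|P. I x * c) = c * (b i * b j * b l)" for c
    unfolding m01[OF borel_measurable_const] integral_B_Times_const[OF ijl(1,2)] by (simp only: mult_ac)
  have Ju: "(LINT x|P. I x * u (C i j) 0 1 x) = b l * W i j"
    "(LINT x|P. I x * u (C i l) 0 2 x) = b j * W i l"
    "(LINT x|P. I x * u (C j l) 1 2 x) = b i * W j l"
    unfolding u_def W_def by (rule m01 m02 m12; measurable)+
  have Ju2: "(LINT x|P. I x * (u (C i j) 0 1 x)\<^sup>2) = b l * Q i j"
    "(LINT x|P. I x * (u (C i l) 0 2 x)\<^sup>2) = b j * Q i l"
    "(LINT x|P. I x * (u (C j l) 1 2 x)\<^sup>2) = b i * Q j l"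
    unfolding u_def Q_def
    by (rule m01[where f = "\<lambda>z. (g' z - C i j)\<^sup>2"] m02[where f = "\<lambda>z. (g' z - C i l)\<^sup>2"]
        m12[where f = "\<lambda>z. (g' z - C j l)\<^sup>2"]; measurable)+
  have c01: "C i j \<in> {0..1}" "C i l \<in> {0..1}" "C j l \<in> {0..1}"
    using C ijl by auto
  note ints = int_t int_1 int_u[OF _ _ c01(1), of 0 1] int_u[OF _ _ c01(2), of 0 2] int_u[OF _ _ c01(3), of 1 2]
    int_u2[OF _ _ c01(1), of 0 1] int_u2[OF _ _ c01(2), of 0 2] int_u2[OF _ _ c01(3), of 1 2]
  define d where "d x = I x * t x - (I x * (C i j * C i l * C j l) +
      (C i l * C j l * (I x * u (C i j) 0 1 x) + C i j * C j l * (I x * u (C i l) 0 2 x) +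
       C i j * C i l * (I x * u (C j l) 1 2 x)))" for x
  define s where "s x = I x * (u (C i j) 0 1 x)\<^sup>2 + I x * (u (C i l) 0 2 x)\<^sup>2 + I x * (u (C j l) 1 2 x)\<^sup>2" for x
  have "integrable P d"
    unfolding d_def using ints by auto
  moreover have "integrable P s"
    unfolding s_def using ints by auto
  moreover have "\<bar>d x\<bar> \<le> s x" for x
  proof (cases "x \<in> (\<Pi>\<^sub>E p\<in>{..<3}. B ([i, j, l] ! p))")
    case True
    then have "I x = 1" by (simp add: I_def)
    then show ?thesis
      using triple_product_expansion[OF c01 g'01[of "(x 0, x 1)"] g'01[of "(x 0, x 2)"] g'01[of "(x 1, x 2)"]]
      by (simp add: d_def s_def t_def u_def add.assoc)
  next
    case False
    then have "I x = 0" by (simp add: I_def)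
    then show ?thesis by (simp add: d_def s_def)
  qed
  ultimately have "\<bar>LINT x|P. d x\<bar> \<le> (LINT x|P. s x)"
    by (intro order_trans[OF integral_abs_bound] integral_mono) auto
  moreover have "(LINT x|P. s x) = b l * Q i j + b j * Q i l + b i * Q j l"
    unfolding s_def Ju2[symmetric] using ints by simp
  moreover have "(LINT x|P. d x) = (LINT x|P. I x * t x) - (C i j * C i l * C j l * (b i * b j * b l) +
        (C i l * C j l * (b l * W i j) + C i j * C j l * (b j * W i l) + C i j * C i l * (b i * W j l)))"
    unfolding d_def J1[symmetric] Ju[symmetric] using ints by simp
  moreover have "colored_density B [i, j, l] triangle_graph g = (LINT x|P. I x * t x)"
    unfolding P_def I_def t_def by (rule triangle_density_eq[OF g' ijl])
  ultimately show ?thesis by simp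
qed

definition objective :: "kernel \<Rightarrow> real" where
  "objective g =
     1/6 * (\<Sum>i<k. \<Sum>j<k. \<Sum>l<k. \<alpha> i j l * colored_density B [i, j, l] triangle_graph g) +
     1/2 * (\<Sum>i<k. \<Sum>j<k. h i j * colored_density B [i, j] edge_graph g) -
     1/2 * (\<Sum>i<k. \<Sum>j<k. LINT z:B i \<times> B j|lebesgue. neg_entropy (g z))"

text \<open>The squared L2 distance from the block kernel of \<open>C\<close>, taken blockwise so
  that \<open>C i j\<close> enters as a constant.\<close>

definition deficit :: "(nat \<Rightarrow> nat \<Rightarrow> real) \<Rightarrow> kernel \<Rightarrow> real" where
  "deficit C g = (\<Sum>i<k. \<Sum>j<k. LINT z:B i \<times> B j|lebesgue. (g z - C i j)\<^sup>2)"

lemma deficit_nonneg: "0 \<le> deficit C g"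
  unfolding deficit_def set_lebesgue_integral_def by (intro sum_nonneg integral_nonneg_AE) simp

lemma objective_le:
  assumes g: "g \<in> graphons" and C: "solves_system k b \<alpha> h C"
  shows "objective g \<le> block_value C - (1 - A / 2) * deficit C g"
proof -
  obtain g' where g': "borel_version g g'" using graphon_borel_version[OF g] .
  have g'm[measurable]: "g' \<in> borel_measurable borel" and g'01: "\<And>z. g' z \<in> {0..1}"
    using g' by (auto simp: borel_version_def)
  define W where "W i j = (LINT z|lborel. indicator (B i \<times> B j) z * (g' z - C i j))" for i j
  define Q where "Q i j = (LINT z|lborel. indicator (B i \<times> B j) z * (g' z - C i j)\<^sup>2)" for i j
  \<comment> \<open>Entries of a solution are logistic values and hence lie strictly inside the unit
    interval, where \<open>neg_entropy\<close> has a tangent.\<close>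
  have C01: "C i j \<in> {0..1}" and Cint: "0 < C i j" "C i j < 1" if "i < k" "j < k" for i j
    using C that logistic_bounds[of "field C i j"] by (auto simp: solves_system_iff less_imp_le)
  have int_W: "integrable lborel (\<lambda>z. indicator (B i \<times> B j) z * (g' z - C i j))"
    and int_Q: "integrable lborel (\<lambda>z. indicator (B i \<times> B j) z * (g' z - C i j)\<^sup>2)"
    and int_c: "integrable lborel (\<lambda>z. indicator (B i \<times> B j) z * c)"
    and int_S: "integrable lborel (\<lambda>z. indicator (B i \<times> B j) z * neg_entropy (g' z))"
    if ij: "i < k" "j < k" for i j and c :: real
  proof -
    have le: "\<bar>g' z - C i j\<bar> \<le> 1" for z
      using g'01[of z] C01[OF ij] by auto
    show "integrable lborel (\<lambda>z. indicator (B i \<times> B j) z * (g' z - C i j))"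
      by (rule integrable_B_Times[OF ij, where K = 1]) (use le in auto)
    show "integrable lborel (\<lambda>z. indicator (B i \<times> B j) z * (g' z - C i j)\<^sup>2)"
      by (rule integrable_B_Times[OF ij, where K = 1]) (use le in \<open>auto simp: abs_square_le_1\<close>)
    show "integrable lborel (\<lambda>z. indicator (B i \<times> B j) z * c)"
      by (rule integrable_B_Times[OF ij, where K = "\<bar>c\<bar>"]) auto
    show "integrable lborel (\<lambda>z. indicator (B i \<times> B j) z * neg_entropy (g' z))"
      by (rule integrable_B_Times[OF ij, where K = "ln 2"]) (use neg_entropy_abs_le[OF g'01] in auto)
  qed
  have "deficit C g = (\<Sum>i<k. \<Sum>j<k. Q i j)"
    unfolding deficit_def Q_def
    by (intro sum.cong refl LINT_B_Times_borel_version[OF g']) auto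
  moreover have "objective g \<le> block_value C - (1 - A / 2) * (\<Sum>i<k. \<Sum>j<k. Q i j)"
    unfolding objective_def
  proof (rule block_value_bound[OF C])
    show "0 \<le> Q i j" if "i < k" "j < k" for i j
      unfolding Q_def by (intro integral_nonneg_AE) simp
    show "\<bar>colored_density B [i, j, l] triangle_graph g - (C i j * C i l * C j l * (b i * b j * b l) +
        (C i l * C j l * (b l * W i j) + C i j * C j l * (b j * W i l) + C i j * C i l * (b i * W j l)))\<bar>
      \<le> b l * Q i j + b j * Q i l + b i * Q j l" if "i < k" "j < k" "l < k" for i j l
      using triangle_density_bound[where C = C, OF g' that C01] unfolding W_def Q_def .
    show "colored_density B [i, j] edge_graph g = C i j * (b i * b j) + W i j" if ij: "i < k" "j < k" for i j
    proof -
      have "(LINT z|lborel. indicator (B i \<times> B j) z * g' z) =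
          (LINT z|lborel. indicator (B i \<times> B j) z * C i j + indicator (B i \<times> B j) z * (g' z - C i j))"
        by (simp add: algebra_simps)
      also have "\<dots> = C i j * (b i * b j) + W i j"
        using int_c[OF ij] int_W[OF ij] integral_B_Times_const[OF ij] by (simp add: W_def)
      finally show ?thesis using edge_density_eq[OF g' ij] by simp
    qed
    show "neg_entropy (C i j) * (b i * b j) + (ln (C i j) - ln (1 - C i j)) * W i j + 2 * Q i j
        \<le> (LINT z:B i \<times> B j|lebesgue. neg_entropy (g z))" if ij: "i < k" "j < k" for i j
    proof -
      let ?I = "indicator (B i \<times> B j) :: real \<times> real \<Rightarrow> real"
      let ?\<theta> = "ln (C i j) - ln (1 - C i j)"
      have "neg_entropy (C i j) * (b i * b j) + ?\<theta> * W i j + 2 * Q i j =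
          (LINT z|lborel. ?I z * neg_entropy (C i j) + ?\<theta> * (?I z * (g' z - C i j)) + 2 * (?I z * (g' z - C i j)\<^sup>2))"
        unfolding W_def Q_def integral_B_Times_const[OF ij, symmetric]
        using int_c[OF ij] int_W[OF ij] int_Q[OF ij] by simp
      also have "\<dots> \<le> (LINT z|lborel. ?I z * neg_entropy (g' z))"
      proof (rule integral_mono)
        show "integrable lborel (\<lambda>z. ?I z * neg_entropy (C i j) + ?\<theta> * (?I z * (g' z - C i j)) + 2 * (?I z * (g' z - C i j)\<^sup>2))"
          using int_c[OF ij] int_W[OF ij] int_Q[OF ij] by auto
        show "integrable lborel (\<lambda>z. ?I z * neg_entropy (g' z))"
          by (rule int_S[OF ij])
        fix z
        show "?I z * neg_entropy (C i j) + ?\<theta> * (?I z * (g' z - C i j)) + 2 * (?I z * (g' z - C i j)\<^sup>2)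
            \<le> ?I z * neg_entropy (g' z)"
          using neg_entropy_tangent_bound[of "g' z" "C i j"] g'01[of z] Cint[OF ij]
          by (cases "z \<in> B i \<times> B j") auto
      qed
      also have "\<dots> = (LINT z:B i \<times> B j|lebesgue. neg_entropy (g z))"
        using LINT_B_Times_borel_version[OF g' ij neg_entropy_measurable] by simp
      finally show ?thesis .
    qed
  qed
  ultimately show ?thesis by simp
qed

end

section \<open>Block kernels\<close>

lemma AE_lebesgue_on_unit_square:
  "(AE z in lebesgue_on unit_square. R z) \<longleftrightarrow> (AE z in lebesgue. z \<in> unit_square \<longrightarrow> R z)"
  using unit_square_borel by (intro AE_restrict_space_iff) auto

lemma graphon_bounds: "g \<in> graphons \<Longrightarrow> z \<in> unit_square \<Longrightarrow> 0 \<le> g z \<and> g z \<le> 1"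
  by (cases z) (auto simp: graphons_def)

lemma graphon_measurable:
  assumes "g \<in> graphons"
  shows "(\<lambda>z. indicator unit_square z * g z) \<in> borel_measurable lebesgue"
proof -
  have "(\<lambda>z. if z \<in> unit_square then g z else 0) \<in> borel_measurable lebesgue"
    using assms unit_square_borel by (subst borel_measurable_if) (auto simp: graphons_def)
  then show ?thesis
    by (rule measurable_cong[THEN iffD1, rotated]) (auto simp: indicator_def)
qed

text \<open>Rectangles form an intersection-stable generator of the Borel sets, so the integral of
  \<open>F\<close> vanishes over every Borel set, and a density is determined almost everywhere by
  such integrals.\<close>

lemma integral_zero_of_rectangles:
  fixes F :: "real \<times> real \<Rightarrow> real"
  assumes F: "integrable lborel F"
    and rect: "\<And>X Y. X \<in> sets borel \<Longrightarrow> Y \<in> sets borel \<Longrightarrow> (LINT z:X \<times> Y|lborel. F z) = 0"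
  shows "AE z in lborel. F z = 0"
proof -
  let ?E = "{X \<times> Y | X Y. X \<in> sets (borel :: real measure) \<and> Y \<in> sets (borel :: real measure)}"
  have borel: "sets (borel :: (real \<times> real) measure) = sigma_sets UNIV ?E"
    using sets_pair_measure[of "borel :: real measure" "borel :: real measure"]
    by (simp only: borel_prod space_borel UNIV_Times_UNIV)
  have si: "set_integrable lborel X F" if "X \<in> sets borel" for X
    unfolding set_integrable_def using integrable_mult_indicator[OF _ F, of X] that by simp
  have zero: "(LINT z:X|lborel. F z) = 0" if "X \<in> sets borel" for X
  proof -
    have "Int_stable ?E"
      by (rule Int_stable_pair_measure_generator)
    moreover have "?E \<subseteq> Pow UNIV" by simp
    moreover have "X \<in> sigma_sets UNIV ?E" using that borel by simp
    ultimately show ?thesis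
    proof (induction rule: sigma_sets_induct_disjoint)
      case (basic A)
      then show ?case using rect by auto
    next
      case empty
      then show ?case by (simp add: set_lebesgue_integral_def)
    next
      \<comment> \<open>The whole plane is itself a rectangle, which settles complements.\<close>
      case (compl A)
      then have "A \<in> sets borel" using borel by simp
      then have "(LINT z:A \<union> (UNIV - A)|lborel. F z) = (LINT z:A|lborel. F z) + (LINT z:UNIV - A|lborel. F z)"
        by (intro set_integral_Un si) auto
      moreover have "(LINT z:A \<union> (UNIV - A)|lborel. F z) = 0"
        using rect[of UNIV UNIV] by simp
      ultimately show ?case using compl by simp
    next
      case (union A)
      then have "\<And>i. A i \<in> sets borel" using borel by auto
      then have "(LINT z:(\<Union>i. A i)|lborel. F z) = (\<Sum>i. LINT z:A i|lborel. F z)"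
        using union(1) by (intro lebesgue_integral_countable_add si) (auto simp: disjoint_family_on_def)
      then show ?case using union by simp
    qed
  qed
  have "AE z in lborel. F z = (\<lambda>_. 0) z"
    using zero F by (intro density_unique_real) (auto simp: set_lebesgue_integral_def)
  then show ?thesis by simp
qed

section \<open>Block kernels as graphons and the case of equality\<close>

context colored_system
begin

lemma B_disjoint:
  assumes "i < k" "j < k" "x \<in> B i" "x \<in> B j"
  shows "i = j"
  using B assms unfolding color_partition_def by (cases i j rule: linorder_cases) force+

lemma B_cover: "x \<in> {0..1} \<Longrightarrow> \<exists>i<k. x \<in> B i"
  using B by (auto simp: color_partition_def)

lemma block_kernel_eq:
  assumes "i < k" "j < k" "x \<in> B i" "y \<in> B j"
  shows "block_kernel k B C (x, y) = C i j"
proof -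
  have ind: "indicator (B p) z = (if p = q then 1 else 0 :: real)" if "p < k" "q < k" "z \<in> B q" for p q z
  proof -
    have "z \<in> B p \<longleftrightarrow> p = q" using B_disjoint[OF that(1,2)] that by blast
    then show ?thesis by (simp only: indicator_def of_bool_def)
  qed
  have "block_kernel k B C (x, y) =
      (\<Sum>p<k. \<Sum>q<k. if p = i \<and> q = j then C i j else 0)"
    unfolding block_kernel_def prod.case
    by (intro sum.cong refl) (auto simp: ind[OF _ assms(1,3)] ind[OF _ assms(2,4)])
  also have "\<dots> = (\<Sum>p<k. if p = i then C i j else 0)"
    using assms(2) by (intro sum.cong refl) auto
  also have "\<dots> = C i j"
    using assms(1) by simp
  finally show ?thesis .
qed

lemma block_kernel_outside:
  assumes "z \<notin> unit_square"
  shows "block_kernel k B C z = 0"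
proof -
  obtain x y where z: "z = (x, y)" by (cases z)
  have "indicator (B i) x * indicator (B j) y = (0 :: real)" if "i < k" "j < k" for i j
    using assms B_subset[OF that(1)] B_subset[OF that(2)] by (auto simp: z indicator_def)
  then show ?thesis
    unfolding z block_kernel_def prod.case mult.assoc by (intro sum.neutral ballI) simp
qed

lemma block_kernel_measurable: "block_kernel k B C \<in> borel_measurable borel"
proof -
  have "(\<lambda>z. \<Sum>i<k. \<Sum>j<k. C i j * indicator (B i) (fst z) * indicator (B j) (snd z)) \<in> borel_measurable borel"
  proof (intro borel_measurable_sum borel_measurable_times borel_measurable_const)
    fix i assume "i \<in> {..<k}"
    then have [measurable]: "B i \<in> sets borel" using B_borel by simp
    show "(\<lambda>z :: real \<times> real. indicator (B i) (fst z) :: real) \<in> borel_measurable borel"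
      by (rule measurable_compose[OF borel_measurable_continuous_onI]) (auto intro: continuous_on_fst continuous_on_id)
    show "(\<lambda>z :: real \<times> real. indicator (B i) (snd z) :: real) \<in> borel_measurable borel"
      by (rule measurable_compose[OF borel_measurable_continuous_onI]) (auto intro: continuous_on_snd continuous_on_id)
  qed
  then show ?thesis by (simp add: block_kernel_def case_prod_beta)
qed

lemma block_kernel_bounds:
  assumes "\<And>i j. i < k \<Longrightarrow> j < k \<Longrightarrow> C i j \<in> {0..1}"
  shows "block_kernel k B C z \<in> {0..1}"
proof (cases "z \<in> unit_square")
  case True
  then obtain x y where z: "z = (x, y)" "x \<in> {0..1}" "y \<in> {0..1}" by auto
  then obtain i j where "i < k" "x \<in> B i" "j < k" "y \<in> B j" using B_cover by meson
  then show ?thesis using assms by (simp add: z block_kernel_eq)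
qed (simp add: block_kernel_outside)

lemma solution_bounds:
  assumes "solves_system k b \<alpha> h C" "i < k" "j < k"
  shows "C i j \<in> {0..1}"
  using assms logistic_bounds[of "field C i j"] by (auto simp: solves_system_iff less_imp_le)

lemma block_kernel_graphon:
  assumes C: "solves_system k b \<alpha> h C"
  shows "block_kernel k B C \<in> graphons"
proof -
  have "block_kernel k B C (x, y) = block_kernel k B C (y, x)" if xy: "x \<in> {0..1}" "y \<in> {0..1}" for x y
  proof -
    obtain i j where ij: "i < k" "x \<in> B i" "j < k" "y \<in> B j" using B_cover xy by meson
    moreover have "C i j = C j i" using C ij by (simp add: solves_system_iff)
    ultimately show ?thesis by (simp add: block_kernel_eq)
  qed
  moreover have "block_kernel k B C \<in> borel_measurable (lebesgue_on unit_square)"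
    using block_kernel_measurable by (intro measurable_restrict_space1 measurable_completion) simp
  moreover have "block_kernel k B C z \<in> {0..1}" for z
    using block_kernel_bounds solution_bounds[OF C] by blast
  ultimately show ?thesis by (auto simp: graphons_def)
qed

definition block_ae :: "(nat \<Rightarrow> nat \<Rightarrow> real) \<Rightarrow> kernel \<Rightarrow> bool" where
  "block_ae C g \<longleftrightarrow> (AE z in lebesgue. z \<in> unit_square \<longrightarrow> g z = block_kernel k B C z)"

text \<open>The block kernel is itself a Borel version of \<open>g\<close>. With it all deviations
  vanish on the blocks, so the error bound of \<open>triangle_density_bound\<close> is 0 and
  evaluates the triangle density exactly.\<close>

lemma objective_block:
  assumes C: "solves_system k b \<alpha> h C" and g: "block_ae C g"
  shows "objective g = block_value C"
proof -
  let ?f = "block_kernel k B C"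
  have f: "borel_version g ?f"
    using g block_kernel_measurable block_kernel_bounds solution_bounds[OF C]
    by (auto simp: borel_version_def block_ae_def AE_completion_iff simp del: atLeastAtMost_iff)
  have on: "indicator (B i \<times> B j) z * \<phi> (?f z) = indicator (B i \<times> B j) z * \<phi> (C i j)"
    if "i < k" "j < k" for i j z and \<phi> :: "real \<Rightarrow> real"
    using that by (cases "z \<in> B i \<times> B j") (auto simp: block_kernel_eq)
  have T: "colored_density B [i, j, l] triangle_graph g = C i j * C i l * C j l * (b i * b j * b l)"
    if "i < k" "j < k" "l < k" for i j l
  proof -
    have zero: "indicator (B i \<times> B j) z * (?f z - C i j) = 0" "indicator (B i \<times> B j) z * (?f z - C i j)\<^sup>2 = 0"
      if "i < k" "j < k" for i j z
      using on[OF that, of z "\<lambda>u. u - C i j"] on[OF that, of z "\<lambda>u. (u - C i j)\<^sup>2"] by simp_all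
    have "\<bar>colored_density B [i, j, l] triangle_graph g - C i j * C i l * C j l * (b i * b j * b l)\<bar> \<le> 0"
      using triangle_density_bound[where C = C, OF f that solution_bounds[OF C]]
      unfolding zero[OF that(1,2)] zero[OF that(1,3)] zero[OF that(2,3)] by simp
    then show ?thesis by simp
  qed
  have E: "colored_density B [i, j] edge_graph g = C i j * (b i * b j)" if "i < k" "j < k" for i j
    unfolding edge_density_eq[OF f that] on[OF that, where \<phi> = "\<lambda>u. u"] integral_B_Times_const[OF that] ..
  have S: "(LINT z:B i \<times> B j|lebesgue. neg_entropy (g z)) = neg_entropy (C i j) * (b i * b j)" if "i < k" "j < k" for i j
    unfolding LINT_B_Times_borel_version[OF f that neg_entropy_measurable]
      on[OF that, where \<phi> = neg_entropy] integral_B_Times_const[OF that] ..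
  show ?thesis
    unfolding objective_def block_value_def by (simp add: T E S)
qed

lemma deficit_eq_0_imp:
  assumes g: "g \<in> graphons" and C: "solves_system k b \<alpha> h C" and 0: "deficit C g = 0"
  shows "block_ae C g"
proof -
  obtain g' where g': "borel_version g g'" using graphon_borel_version[OF g] .
  have g'm[measurable]: "g' \<in> borel_measurable borel" and g'01: "\<And>z. g' z \<in> {0..1}"
    using g' by (auto simp: borel_version_def)
  have eq: "(LINT z:B i \<times> B j|lebesgue. (g z - C i j)\<^sup>2) = (LINT z|lborel. indicator (B i \<times> B j) z * (g' z - C i j)\<^sup>2)"
    if "i < k" "j < k" for i j
    by (rule LINT_B_Times_borel_version[OF g' that]) auto
  have nn: "0 \<le> (LINT z:B i \<times> B j|lebesgue. (g z - C i j)\<^sup>2)" for i j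
    unfolding set_lebesgue_integral_def by (intro integral_nonneg_AE) simp
  have ae: "AE z in lborel. z \<in> B i \<times> B j \<longrightarrow> g' z = C i j" if ij: "i < k" "j < k" for i j
  proof -
    have "(\<Sum>j<k. LINT z:B i \<times> B j|lebesgue. (g z - C i j)\<^sup>2) = 0"
      using 0 ij unfolding deficit_def by (subst (asm) sum_nonneg_eq_0_iff) (auto intro!: sum_nonneg nn)
    then have "(LINT z:B i \<times> B j|lebesgue. (g z - C i j)\<^sup>2) = 0"
      using ij by (subst (asm) sum_nonneg_eq_0_iff) (auto intro: nn)
    then have "(LINT z|lborel. indicator (B i \<times> B j) z * (g' z - C i j)\<^sup>2) = 0"
      by (simp add: eq[OF ij])
    moreover have "\<bar>g' z - C i j\<bar> \<le> 1" for z
      using g'01[of z] solution_bounds[OF C ij] by auto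
    then have "integrable lborel (\<lambda>z. indicator (B i \<times> B j) z * (g' z - C i j)\<^sup>2)"
      by (intro integrable_B_Times[OF ij, where K = 1]) (auto simp: abs_square_le_1)
    ultimately have "AE z in lborel. indicator (B i \<times> B j) z * (g' z - C i j)\<^sup>2 = 0"
      by (subst (asm) integral_nonneg_eq_0_iff_AE) auto
    then show ?thesis
      by eventually_elim (auto simp: indicator_def)
  qed
  have "AE z in lborel. \<forall>(i, j)\<in>{..<k} \<times> {..<k}. z \<in> B i \<times> B j \<longrightarrow> g' z = C i j"
    by (rule AE_finite_allI) (use ae in \<open>auto simp del: mem_Sigma_iff\<close>)
  moreover have "AE z in lborel. z \<in> unit_square \<longrightarrow> g z = g' z"
    using g' by (simp add: borel_version_def)
  ultimately have "AE z in lborel. z \<in> unit_square \<longrightarrow> g z = block_kernel k B C z"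
  proof eventually_elim
    case (elim z)
    show ?case
    proof
      assume z: "z \<in> unit_square"
      then obtain x y where xy: "z = (x, y)" "x \<in> {0..1}" "y \<in> {0..1}" by auto
      then obtain i j where "i < k" "x \<in> B i" "j < k" "y \<in> B j" using B_cover by meson
      then show "g z = block_kernel k B C z"
        using elim z by (auto simp: xy block_kernel_eq)
    qed
  qed
  then show ?thesis by (simp add: block_ae_def AE_completion_iff)
qed

end

section \<open>The cut metric near a block kernel\<close>

text \<open>Preserving Lebesgue measure on the whole line lets the product map be handled without restricted product measures.\<close>
definition extend_id :: "(real \<Rightarrow> real) \<Rightarrow> real \<Rightarrow> real" where
  "extend_id \<sigma> x = (if x \<in> {0..1} then \<sigma> x else x)"

text \<open>A preimage splits along the unit interval, which both pieces of the map respect: inside,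
  \<sigma> preserves measure by assumption, and outside the map is the identity.\<close>

lemma extend_id_preserves_lebesgue:
  assumes m: "\<sigma> \<in> lebesgue_on {0..1} \<rightarrow>\<^sub>M lebesgue_on {0..1}"
    and d: "distr (lebesgue_on {0..1}) (lebesgue_on {0..1}) \<sigma> = lebesgue_on {0..1}"
  shows "extend_id \<sigma> \<in> lebesgue \<rightarrow>\<^sub>M lebesgue" "distr lebesgue lebesgue (extend_id \<sigma>) = lebesgue"
proof -
  have unit: "{0..1 :: real} \<in> sets lebesgue" by simp
  have maps: "\<sigma> x \<in> {0..1}" if "x \<in> {0..1}" for x
    using measurable_space[OF m, of x] that by simp
  have part: "\<sigma> -` (A \<inter> {0..1}) \<inter> {0..1} \<in> sets lebesgue"
      "emeasure lebesgue (\<sigma> -` (A \<inter> {0..1}) \<inter> {0..1}) = emeasure lebesgue (A \<inter> {0..1})"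
    if A: "A \<in> sets lebesgue" for A
  proof -
    have A': "A \<inter> {0..1} \<in> sets (lebesgue_on {0..1})"
      using A by (auto simp: sets_restrict_space)
    have pre: "\<sigma> -` (A \<inter> {0..1}) \<inter> {0..1} \<in> sets (lebesgue_on {0..1})"
      using measurable_sets[OF m A'] by simp
    then show 1: "\<sigma> -` (A \<inter> {0..1}) \<inter> {0..1} \<in> sets lebesgue"
      using unit by (subst (asm) sets_restrict_space_iff) auto
    have "emeasure (distr (lebesgue_on {0..1}) (lebesgue_on {0..1}) \<sigma>) (A \<inter> {0..1}) =
        emeasure (lebesgue_on {0..1}) (\<sigma> -` (A \<inter> {0..1}) \<inter> {0..1})"
      using m A' by (subst emeasure_distr) auto
    then show "emeasure lebesgue (\<sigma> -` (A \<inter> {0..1}) \<inter> {0..1}) = emeasure lebesgue (A \<inter> {0..1})"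
      using unit by (simp only: d emeasure_restrict_space[of "{0..1}" lebesgue] space_completion) (simp add: emeasure_restrict_space)
  qed
  have vimage: "extend_id \<sigma> -` A = (\<sigma> -` (A \<inter> {0..1}) \<inter> {0..1}) \<union> (A - {0..1})" for A
    using maps by (auto simp: extend_id_def split: if_splits)
  show meas: "extend_id \<sigma> \<in> lebesgue \<rightarrow>\<^sub>M lebesgue"
  proof (rule measurableI)
    fix A :: "real set" assume "A \<in> sets lebesgue"
    then show "extend_id \<sigma> -` A \<inter> space lebesgue \<in> sets lebesgue"
      using part(1) unit by (simp only: vimage space_completion space_lborel space_borel Int_UNIV_right) (intro sets.Un sets.Diff; simp)
  qed simp
  show "distr lebesgue lebesgue (extend_id \<sigma>) = lebesgue"
  proof (rule measure_eqI)
    fix A :: "real set" assume "A \<in> sets (distr lebesgue lebesgue (extend_id \<sigma>))"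
    then have A: "A \<in> sets lebesgue" by simp
    have "emeasure (distr lebesgue lebesgue (extend_id \<sigma>)) A =
        emeasure lebesgue ((\<sigma> -` (A \<inter> {0..1}) \<inter> {0..1}) \<union> (A - {0..1}))"
      using meas A by (subst emeasure_distr) (auto simp: vimage)
    also have "\<dots> = emeasure lebesgue (A \<inter> {0..1}) + emeasure lebesgue (A - {0..1})"
      using part[OF A] A unit
      by (subst plus_emeasure[symmetric]) (auto simp del: emeasure_completion)
    also have "\<dots> = emeasure lebesgue ((A \<inter> {0..1}) \<union> (A - {0..1}))"
      using A unit by (intro plus_emeasure) auto
    also have "(A \<inter> {0..1}) \<union> (A - {0..1}) = A" by auto
    finally show "emeasure (distr lebesgue lebesgue (extend_id \<sigma>)) A = emeasure lebesgue A" .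
  qed simp
qed

section \<open>The cut distance through pairs of test sets\<close>

context colored_system
begin

definition block_gap :: "kernel \<Rightarrow> kernel \<Rightarrow> real set \<Rightarrow> real set \<Rightarrow> real" where
  "block_gap g1 g2 C D =
     (\<Sum>i<k. \<Sum>j<k. \<bar>LINT z:C \<times> D|lebesgue. indicator (B i \<times> B j) z * (g1 z - g2 z)\<bar>)"

lemma colored_cut_dist_alt:
  "colored_cut_dist k B g1 g2 =
     (SUP (C, D) \<in> sets (lebesgue_on {0..1}) \<times> sets (lebesgue_on {0..1}). block_gap g1 g2 C D)"
  by (simp add: colored_cut_dist_def block_gap_def)

lemma block_gap_nonneg: "0 \<le> block_gap g1 g2 C D"
  unfolding block_gap_def by (intro sum_nonneg) auto

text \<open>A crude bound, uniform in the test sets: a supremum of reals can be used as an upper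
  bound only once the set is known to be bounded above.\<close>

lemma block_gap_le:
  assumes "\<And>z. z \<in> unit_square \<Longrightarrow> 0 \<le> g1 z \<and> g1 z \<le> 1" "\<And>z. z \<in> unit_square \<Longrightarrow> 0 \<le> g2 z \<and> g2 z \<le> 1"
  shows "block_gap g1 g2 C D \<le> (\<Sum>i<k. \<Sum>j<k. measure lebesgue unit_square)"
  unfolding block_gap_def
proof (intro sum_mono)
  fix i j assume "i \<in> {..<k}" "j \<in> {..<k}"
  then have ij: "i < k" "j < k" by auto
  have fin: "emeasure lebesgue unit_square < \<infinity>"
    using emeasure_lebesgue_Times[of "{0..1 :: real}" "{0..1 :: real}"] by simp
  have "\<bar>LINT z:C \<times> D|lebesgue. indicator (B i \<times> B j) z * (g1 z - g2 z)\<bar> \<le>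
      (LINT z|lebesgue. \<bar>indicator (C \<times> D) z * (indicator (B i \<times> B j) z * (g1 z - g2 z))\<bar>)"
    unfolding set_lebesgue_integral_def real_scaleR_def by (rule integral_abs_bound)
  also have "\<dots> \<le> (LINT z|lebesgue. indicator unit_square z)"
  \<comment> \<open>This rule asks for integrability of the dominating function only. An integrand
    that is not integrable has integral 0 by default, so arbitrary \<open>C\<close> and
    \<open>D\<close> are covered.\<close>
  proof (rule integral_mono')
    show "integrable lebesgue (indicator unit_square :: real \<times> real \<Rightarrow> real)"
      using fin unit_square_borel by simp
    fix z
    show "\<bar>indicator (C \<times> D) z * (indicator (B i \<times> B j) z * (g1 z - g2 z))\<bar> \<le> indicator unit_square z"
    proof (cases "z \<in> B i \<times> B j")
      case True
      then have z: "z \<in> unit_square" using B_Times_subset[OF ij] by blast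
      then have "\<bar>g1 z - g2 z\<bar> \<le> 1" using assms[of z] by (auto simp: abs_le_iff)
      then show ?thesis using z by (auto simp: indicator_def abs_mult)
    qed simp
  qed simp
  also have "\<dots> = measure lebesgue unit_square" by simp
  finally show "\<bar>LINT z:C \<times> D|lebesgue. indicator (B i \<times> B j) z * (g1 z - g2 z)\<bar> \<le> measure lebesgue unit_square" .
qed

lemma block_gap_le_cut_dist:
  assumes "\<And>z. z \<in> unit_square \<Longrightarrow> 0 \<le> g1 z \<and> g1 z \<le> 1" "\<And>z. z \<in> unit_square \<Longrightarrow> 0 \<le> g2 z \<and> g2 z \<le> 1"
    and "C \<in> sets (lebesgue_on {0..1})" "D \<in> sets (lebesgue_on {0..1})"
  shows "block_gap g1 g2 C D \<le> colored_cut_dist k B g1 g2"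
  unfolding colored_cut_dist_alt
proof (rule cSUP_upper2[of _ _ "(C, D)"])
  show "bdd_above ((\<lambda>(C, D). block_gap g1 g2 C D) ` (sets (lebesgue_on {0..1}) \<times> sets (lebesgue_on {0..1})))"
  proof (rule bdd_aboveI2)
    fix x assume "x \<in> sets (lebesgue_on {0..1 :: real}) \<times> sets (lebesgue_on {0..1 :: real})"
    show "(case x of (C, D) \<Rightarrow> block_gap g1 g2 C D) \<le> (\<Sum>i<k. \<Sum>j<k. measure lebesgue unit_square)"
      unfolding case_prod_beta by (rule block_gap_le) (use assms in blast)+
  qed
qed (use assms in auto)

lemma cut_dist_nonneg:
  assumes "\<And>z. z \<in> unit_square \<Longrightarrow> 0 \<le> g1 z \<and> g1 z \<le> 1" "\<And>z. z \<in> unit_square \<Longrightarrow> 0 \<le> g2 z \<and> g2 z \<le> 1"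
  shows "0 \<le> colored_cut_dist k B g1 g2"
  using block_gap_le_cut_dist[of g1 g2 "{}" "{}", OF assms] block_gap_nonneg[of g1 g2 "{}" "{}"] by auto

lemma color_preserving_map_id: "(\<lambda>x. x) \<in> color_preserving_maps k B"
proof -
  have "B i \<inter> {0..1} = B i" if "i < k" for i using B_subset[OF that] by auto
  then show ?thesis
    by (auto simp: color_preserving_maps_def distr_id)
qed

lemma color_preserving_map_range:
  assumes "\<sigma> \<in> color_preserving_maps k B" "x \<in> {0..1}"
  shows "\<sigma> x \<in> {0..1}"
proof -
  have m: "\<sigma> \<in> lebesgue_on {0..1} \<rightarrow>\<^sub>M lebesgue_on {0..1}"
    using assms(1) by (simp add: color_preserving_maps_def)
  show ?thesis using measurable_space[OF m, of x] assms(2) by simp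
qed

lemma relabel_bounds:
  assumes "\<sigma> \<in> color_preserving_maps k B" "g \<in> graphons" "z \<in> unit_square"
  shows "0 \<le> relabel \<sigma> g z \<and> relabel \<sigma> g z \<le> 1"
  using assms color_preserving_map_range[OF assms(1)]
  by (cases z) (simp add: relabel_def graphon_bounds del: atLeastAtMost_iff)

text \<open>The test sets may depend on \<sigma>. This freedom lets a lower bound pass to the
  infimum although the relabelling moves the sets.\<close>

lemma block_gap_le_cut_metric:
  assumes g: "g \<in> graphons" and g': "g' \<in> graphons"
    and le: "\<And>\<sigma>. \<sigma> \<in> color_preserving_maps k B \<Longrightarrow>
      \<exists>C\<in>sets (lebesgue_on {0..1}). \<exists>D\<in>sets (lebesgue_on {0..1}). c \<le> block_gap g (relabel \<sigma> g') C D"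
  shows "c \<le> colored_cut_metric k B g g'"
  unfolding colored_cut_metric_def
proof (rule cINF_greatest)
  show "color_preserving_maps k B \<noteq> {}" using color_preserving_map_id by auto
  fix \<sigma> assume \<sigma>: "\<sigma> \<in> color_preserving_maps k B"
  then obtain C D where "C \<in> sets (lebesgue_on {0..1})" "D \<in> sets (lebesgue_on {0..1})"
      "c \<le> block_gap g (relabel \<sigma> g') C D" using le by blast
  then show "c \<le> colored_cut_dist k B g (relabel \<sigma> g')"
    using block_gap_le_cut_dist[of g "relabel \<sigma> g'" C D, OF graphon_bounds[OF g] relabel_bounds[OF \<sigma> g']]
    by simp
qed

text \<open>The identity is colour preserving and realises distance 0, while all competing distances
  are nonnegative.\<close>

lemma cut_metric_eq_0:
  assumes g: "g \<in> graphons" and g': "g' \<in> graphons"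
    and eq: "AE z in lebesgue. z \<in> unit_square \<longrightarrow> g z = g' z"
  shows "colored_cut_metric k B g g' = 0"
proof (rule antisym)
  have nonneg: "0 \<le> colored_cut_dist k B g (relabel \<sigma> g')" if "\<sigma> \<in> color_preserving_maps k B" for \<sigma>
    using cut_dist_nonneg[of g "relabel \<sigma> g'", OF graphon_bounds[OF g] relabel_bounds[OF that g']] .
  then show "0 \<le> colored_cut_metric k B g g'"
    unfolding colored_cut_metric_def using color_preserving_map_id by (intro cINF_greatest) auto
  have id: "relabel (\<lambda>x. x) g' = g'" by (auto simp: relabel_def)
  have "block_gap g g' C D = 0" for C D
  proof -
    have "(LINT z:C \<times> D|lebesgue. indicator (B i \<times> B j) z * (g z - g' z)) = 0" if "i < k" "j < k" for i j
      unfolding set_lebesgue_integral_def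
    proof (rule integral_eq_zero_AE)
      show "AE z in lebesgue. indicator (C \<times> D) z *\<^sub>R (indicator (B i \<times> B j) z * (g z - g' z)) = 0"
        using eq by eventually_elim (use B_Times_subset[OF that] in \<open>auto simp: indicator_def\<close>)
    qed
    then show ?thesis by (simp add: block_gap_def)
  qed
  then have "colored_cut_dist k B g g' = 0"
    unfolding colored_cut_dist_alt case_prod_beta using sets.empty_sets by (simp only:) (blast intro: cSUP_const)
  moreover have "colored_cut_metric k B g g' \<le> colored_cut_dist k B g (relabel (\<lambda>x. x) g')"
    unfolding colored_cut_metric_def using nonneg color_preserving_map_id
    by (intro cINF_lower) (auto intro!: bdd_belowI2)
  ultimately show "colored_cut_metric k B g g' \<le> 0" by (simp add: id)
qed

text \<open>A vanishing gap is a sum of absolute values, so the difference of the kernels has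
  integral 0 over every rectangle within each block, and rectangles determine it.\<close>

lemma block_gap_0_imp_AE_eq:
  assumes g: "g \<in> graphons" and g': "g' \<in> graphons"
    and gap: "\<And>X Y. X \<in> sets borel \<Longrightarrow> Y \<in> sets borel \<Longrightarrow> X \<subseteq> {0..1} \<Longrightarrow> Y \<subseteq> {0..1} \<Longrightarrow> block_gap g g' X Y = 0"
  shows "AE z in lebesgue. z \<in> unit_square \<longrightarrow> g z = g' z"
proof -
  obtain f where f: "borel_version g f" using graphon_borel_version[OF g] .
  obtain f' where f': "borel_version g' f'" using graphon_borel_version[OF g'] .
  have [measurable]: "f \<in> borel_measurable borel" "f' \<in> borel_measurable borel"
    using f f' by (auto simp: borel_version_def)
  have diff: "\<bar>f z - f' z\<bar> \<le> 1" for z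
  proof -
    have "f z \<in> {0..1}" "f' z \<in> {0..1}" using f f' unfolding borel_version_def by blast+
    then show ?thesis by auto
  qed
  have ff': "AE z in lborel. z \<in> unit_square \<longrightarrow> g z = f z \<and> g' z = f' z"
    using f f' by (auto simp: borel_version_def)
  have "AE z in lborel. z \<in> B i \<times> B j \<longrightarrow> f z = f' z" if ij: "i < k" "j < k" for i j
  proof -
    have "AE z in lborel. indicator (B i \<times> B j) z * (f z - f' z) = 0"
    proof (rule integral_zero_of_rectangles)
      show "integrable lborel (\<lambda>z. indicator (B i \<times> B j) z * (f z - f' z))"
        by (rule integrable_B_Times[OF ij _ diff]) simp
      fix X Y :: "real set" assume XY: "X \<in> sets borel" "Y \<in> sets borel"
      \<comment> \<open>Arbitrary Borel sets are cut down to the unit interval, which changes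
        nothing on a block.\<close>
      let ?X = "X \<inter> {0..1}" and ?Y = "Y \<inter> {0..1}"
      have bor: "X \<times> Y \<in> sets borel" using XY borel_Times by blast
      have "block_gap g g' ?X ?Y = 0" using XY by (intro gap) auto
      then have "(\<Sum>j<k. \<bar>LINT z:?X \<times> ?Y|lebesgue. indicator (B i \<times> B j) z * (g z - g' z)\<bar>) = 0"
        using ij unfolding block_gap_def by (subst (asm) sum_nonneg_eq_0_iff) (auto intro!: sum_nonneg)
      then have "0 = (LINT z:?X \<times> ?Y|lebesgue. indicator (B i \<times> B j) z * (g z - g' z))"
        using ij by (subst (asm) sum_nonneg_eq_0_iff) auto
      also have "\<dots> = (LINT z|lborel. indicator (X \<times> Y) z * (indicator (B i \<times> B j) z * (f z - f' z)))"
        unfolding set_lebesgue_integral_def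
      proof (rule integral_completion_AE_eq)
        show "(\<lambda>z. indicator (X \<times> Y) z * (indicator (B i \<times> B j) z * (f z - f' z))) \<in> borel_measurable lborel"
          using bor B_Times_borel[OF ij] by (intro borel_measurable_times borel_measurable_indicator) auto
        show "AE z in lborel. indicator (?X \<times> ?Y) z *\<^sub>R (indicator (B i \<times> B j) z * (g z - g' z)) =
            indicator (X \<times> Y) z * (indicator (B i \<times> B j) z * (f z - f' z))"
          using ff' by eventually_elim (use B_subset[OF ij(1)] B_subset[OF ij(2)] in \<open>auto simp: indicator_def\<close>)
      qed
      finally show "(LINT z:X \<times> Y|lborel. indicator (B i \<times> B j) z * (f z - f' z)) = 0"
        by (simp add: set_lebesgue_integral_def)
    qed
    then show ?thesis by eventually_elim (auto simp: indicator_def)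
  qed
  then have "AE z in lborel. \<forall>(i, j)\<in>{..<k} \<times> {..<k}. z \<in> B i \<times> B j \<longrightarrow> f z = f' z"
    by (intro AE_finite_allI) (auto simp del: mem_Sigma_iff)
  with ff' have "AE z in lborel. z \<in> unit_square \<longrightarrow> g z = g' z"
  proof eventually_elim
    case (elim z)
    show ?case
    proof
      assume z: "z \<in> unit_square"
      then obtain x y where xy: "z = (x, y)" "x \<in> {0..1}" "y \<in> {0..1}" by auto
      then obtain i j where "i < k" "x \<in> B i" "j < k" "y \<in> B j" using B_cover by meson
      then show "g z = g' z"
        using elim z by (auto simp: xy)
    qed
  qed
  then show ?thesis by (simp add: AE_completion_iff)
qed

end

section \<open>Relabelling along colour-preserving maps\<close>

context colored_system
begin

lemma block_integrand_measurable:
  fixes f g :: kernel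
  assumes XY: "X \<in> sets lebesgue" "Y \<in> sets lebesgue" and ij: "i < k" "j < k"
    and fg: "(\<lambda>z. indicator unit_square z * f z) \<in> borel_measurable lebesgue"
      "(\<lambda>z. indicator unit_square z * g z) \<in> borel_measurable lebesgue"
  shows "(\<lambda>z. indicator (X \<times> Y) z * (indicator (B i \<times> B j) z *
      (indicator unit_square z * f z - indicator unit_square z * g z))) \<in> borel_measurable lebesgue"
proof -
  have "X \<times> Y \<in> sets lebesgue" "B i \<times> B j \<in> sets lebesgue"
    using Times_lebesgue_sets[OF XY] B_Times_borel[OF ij] by auto
  then show ?thesis
    by (intro borel_measurable_times[OF _ borel_measurable_times[OF _ borel_measurable_diff[OF fg]]]
        borel_measurable_indicator)
qed

context
  fixes \<sigma> assumes \<sigma>: "\<sigma> \<in> color_preserving_maps k B"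
begin

lemma extend_id_unit: "extend_id \<sigma> x \<in> {0..1} \<longleftrightarrow> x \<in> {0..1}"
  using color_preserving_map_range[OF \<sigma>, of x] by (auto simp: extend_id_def)

lemma extend_id_vimage: "X \<subseteq> {0..1} \<Longrightarrow> extend_id \<sigma> -` X = \<sigma> -` X \<inter> {0..1}"
  by (auto simp: extend_id_def split: if_splits)

lemma extend_id_lebesgue:
  "extend_id \<sigma> \<in> lebesgue \<rightarrow>\<^sub>M lebesgue" "distr lebesgue lebesgue (extend_id \<sigma>) = lebesgue"
  using extend_id_preserves_lebesgue[of \<sigma>] \<sigma> by (auto simp: color_preserving_maps_def)

lemmas map_prod_extend_id_lebesgue = map_prod_preserves_lebesgue[OF extend_id_lebesgue]

lemma extend_id_color:
  "AE x in lebesgue. \<forall>i\<in>{..<k}. extend_id \<sigma> x \<in> B i \<longleftrightarrow> x \<in> B i"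
proof (rule AE_finite_allI)
  fix i assume "i \<in> {..<k}"
  then have i: "i < k" by simp
  have v: "extend_id \<sigma> -` B i = \<sigma> -` B i \<inter> {0..1}"
    using extend_id_vimage B_subset[OF i] by blast
  have "extend_id \<sigma> -` B i \<inter> space lebesgue \<in> sets lebesgue"
    using B_borel[OF i] by (intro measurable_sets[OF extend_id_lebesgue(1)]) auto
  then have "extend_id \<sigma> -` B i \<in> sets lebesgue" by simp
  then have "sym_diff (extend_id \<sigma> -` B i) (B i) \<in> sets lebesgue"
    using B_borel[OF i] by (intro sets.Un sets.Diff) auto
  moreover have "emeasure lebesgue (sym_diff (extend_id \<sigma> -` B i) (B i)) = 0"
    using \<sigma> i unfolding v color_preserving_maps_def by blast
  ultimately have "sym_diff (extend_id \<sigma> -` B i) (B i) \<in> null_sets lebesgue" by (rule null_setsI[rotated])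
  then show "AE x in lebesgue. extend_id \<sigma> x \<in> B i \<longleftrightarrow> x \<in> B i"
    by (rule AE_I') auto
qed simp

lemma map_prod_extend_id_color:
  "AE z in lebesgue. \<forall>i\<in>{..<k}. \<forall>j\<in>{..<k}. map_prod (extend_id \<sigma>) (extend_id \<sigma>) z \<in> B i \<times> B j \<longleftrightarrow> z \<in> B i \<times> B j"
  using AE_lebesgue_fst[OF extend_id_color, where 'b = real] AE_lebesgue_snd[OF extend_id_color, where 'a = real]
  by eventually_elim (auto simp: mem_Times_iff)

lemma map_prod_extend_id_unit:
  "map_prod (extend_id \<sigma>) (extend_id \<sigma>) z \<in> unit_square \<longleftrightarrow> z \<in> unit_square"
  by (cases z) (simp add: extend_id_unit del: atLeastAtMost_iff)

lemma relabel_eq_map_prod: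
  "z \<in> unit_square \<Longrightarrow> relabel \<sigma> g z = g (map_prod (extend_id \<sigma>) (extend_id \<sigma>) z)"
  by (cases z) (simp add: relabel_def extend_id_def)

lemma relabel_measurable:
  assumes "g \<in> graphons"
  shows "(\<lambda>z. indicator unit_square z * relabel \<sigma> g z) \<in> borel_measurable lebesgue"
proof -
  have "(\<lambda>z. indicator unit_square (map_prod (extend_id \<sigma>) (extend_id \<sigma>) z) *
      g (map_prod (extend_id \<sigma>) (extend_id \<sigma>) z)) \<in> borel_measurable lebesgue"
    using measurable_compose[OF map_prod_extend_id_lebesgue(1) graphon_measurable[OF assms]] .
  moreover have "indicator unit_square (map_prod (extend_id \<sigma>) (extend_id \<sigma>) z) *
      g (map_prod (extend_id \<sigma>) (extend_id \<sigma>) z) = indicator unit_square z * relabel \<sigma> g z" for z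
    using map_prod_extend_id_unit[of z] relabel_eq_map_prod[of z g] by (cases "z \<in> unit_square") auto
  ultimately show ?thesis by simp
qed

text \<open>The product map preserves measure, so the exceptional set of \<open>r\<close> pulls back
  to a null set; it also keeps almost every point in its block, where the block kernel is
  constant.\<close>

lemma relabel_block_ae:
  assumes r: "block_ae C r"
  shows "AE z in lebesgue. z \<in> unit_square \<longrightarrow> relabel \<sigma> r z = r z"
proof -
  let ?T = "map_prod (extend_id \<sigma>) (extend_id \<sigma>)"
  have "AE w in distr lebesgue lebesgue ?T. w \<in> unit_square \<longrightarrow> r w = block_kernel k B C w"
    using r unfolding map_prod_extend_id_lebesgue(2) block_ae_def .
  then have "AE z in lebesgue. ?T z \<in> unit_square \<longrightarrow> r (?T z) = block_kernel k B C (?T z)"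
    by (rule AE_distrD[OF map_prod_extend_id_lebesgue(1)])
  then show ?thesis
    using r[unfolded block_ae_def] map_prod_extend_id_color
  proof eventually_elim
    case (elim z)
    show ?case
    proof
      assume z: "z \<in> unit_square"
      then obtain x y where xy: "z = (x, y)" "x \<in> {0..1}" "y \<in> {0..1}" by auto
      then obtain i j where ij: "i < k" "x \<in> B i" "j < k" "y \<in> B j" using B_cover by meson
      then have "?T z \<in> B i \<times> B j" using elim(3) xy by blast
      then have "block_kernel k B C (?T z) = C i j" "block_kernel k B C z = C i j"
        using ij by (auto simp: xy block_kernel_eq)
      then show "relabel \<sigma> r z = r z"
        using elim z map_prod_extend_id_unit relabel_eq_map_prod[OF z] by simp
    qed
  qed
qed

lemma block_gap_relabel_block:
  assumes g: "g \<in> graphons" and r: "r \<in> graphons" "block_ae C r"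
    and XY: "X \<in> sets lebesgue" "Y \<in> sets lebesgue"
  shows "block_gap g (relabel \<sigma> r) X Y = block_gap g r X Y"
proof -
  have "(LINT z:X \<times> Y|lebesgue. indicator (B i \<times> B j) z * (g z - relabel \<sigma> r z)) =
      (LINT z:X \<times> Y|lebesgue. indicator (B i \<times> B j) z * (g z - r z))" if ij: "i < k" "j < k" for i j
  proof -
    let ?u = "indicator unit_square :: real \<times> real \<Rightarrow> real"
    let ?I = "indicator (B i \<times> B j) :: real \<times> real \<Rightarrow> real"
    have m: "(\<lambda>z. indicator (X \<times> Y) z * (?I z * (?u z * g z - ?u z * f z))) \<in> borel_measurable lebesgue"
      if "(\<lambda>z. ?u z * f z) \<in> borel_measurable lebesgue" for f
      by (rule block_integrand_measurable[OF XY ij graphon_measurable[OF g] that])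
    \<comment> \<open>Kernels are arbitrary outside the square, so the indicator of the square is
      inserted to obtain integrands measurable on the whole plane.\<close>
    have u: "indicator (X \<times> Y) z *\<^sub>R (?I z * (g z - f z)) = indicator (X \<times> Y) z * (?I z * (?u z * g z - ?u z * f z))" for f z
      using B_Times_subset[OF ij] by (auto simp: indicator_def)
    show ?thesis
      unfolding set_lebesgue_integral_def u
    proof (rule integral_cong_AE[OF m[OF relabel_measurable[OF r(1)]] m[OF graphon_measurable[OF r(1)]]])
      show "AE z in lebesgue. indicator (X \<times> Y) z * (?I z * (?u z * g z - ?u z * relabel \<sigma> r z)) =
          indicator (X \<times> Y) z * (?I z * (?u z * g z - ?u z * r z))"
        using relabel_block_ae[OF r(2)] by eventually_elim (auto simp: indicator_def)
    qed
  qed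
  then show ?thesis by (simp add: block_gap_def)
qed

text \<open>
  Change of variables along the map. The two kernels play different roles because only the block
  kernel survives the relabelling unchanged.
\<close>
lemma block_gap_vimage:
  assumes r: "r \<in> graphons" "block_ae C r" and g: "g \<in> graphons"
    and XY: "X \<in> sets lebesgue" "Y \<in> sets lebesgue" "X \<subseteq> {0..1}" "Y \<subseteq> {0..1}"
  shows "block_gap r (relabel \<sigma> g) (\<sigma> -` X \<inter> {0..1}) (\<sigma> -` Y \<inter> {0..1}) = block_gap r g X Y"
proof -
  let ?T = "map_prod (extend_id \<sigma>) (extend_id \<sigma>)"
  let ?X = "\<sigma> -` X \<inter> {0..1}" and ?Y = "\<sigma> -` Y \<inter> {0..1}"
  have vX: "extend_id \<sigma> -` X = ?X" and vY: "extend_id \<sigma> -` Y = ?Y"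
    using XY extend_id_vimage by blast+
  have sX: "?X \<in> sets lebesgue" and sY: "?Y \<in> sets lebesgue"
    using measurable_sets[OF extend_id_lebesgue(1) XY(1)] measurable_sets[OF extend_id_lebesgue(1) XY(2)]
    by (simp_all add: vX vY)
  have "(LINT z:?X \<times> ?Y|lebesgue. indicator (B i \<times> B j) z * (r z - relabel \<sigma> g z)) =
      (LINT z:X \<times> Y|lebesgue. indicator (B i \<times> B j) z * (r z - g z))" if ij: "i < k" "j < k" for i j
  proof -
    let ?u = "indicator unit_square :: real \<times> real \<Rightarrow> real"
    let ?I = "indicator (B i \<times> B j) :: real \<times> real \<Rightarrow> real"
    define F where "F z = indicator (X \<times> Y) z * (?I z * (?u z * r z - ?u z * g z))" for z
    have F: "F \<in> borel_measurable lebesgue"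
      unfolding F_def
      by (rule block_integrand_measurable[OF XY(1,2) ij graphon_measurable[OF r(1)] graphon_measurable[OF g]])
    define F' where "F' z = indicator (?X \<times> ?Y) z * (?I z * (?u z * r z - ?u z * relabel \<sigma> g z))" for z
    have F': "F' \<in> borel_measurable lebesgue"
      unfolding F'_def
      by (rule block_integrand_measurable[OF sX sY ij graphon_measurable[OF r(1)] relabel_measurable[OF g]])
    have "(LINT z:X \<times> Y|lebesgue. ?I z * (r z - g z)) = (LINT z|lebesgue. F z)"
      unfolding set_lebesgue_integral_def F_def
      using B_Times_subset[OF ij] by (intro Bochner_Integration.integral_cong) (auto simp: indicator_def)
    also have "\<dots> = (LINT z|distr lebesgue lebesgue ?T. F z)"
      by (simp only: map_prod_extend_id_lebesgue(2))
    also have "\<dots> = (LINT z|lebesgue. F (?T z))"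
      by (rule integral_distr[OF map_prod_extend_id_lebesgue(1) F])
    also have "\<dots> = (LINT z|lebesgue. F' z)"
    proof (rule integral_cong_AE[OF measurable_compose[OF map_prod_extend_id_lebesgue(1) F] F'])
      \<comment> \<open>The test sets pull back exactly, the blocks up to a null set, and
        \<open>r\<close> is unchanged almost everywhere.\<close>
      show "AE z in lebesgue. F (?T z) = F' z"
        using relabel_block_ae[OF r(2)] map_prod_extend_id_color
      proof eventually_elim
        case (elim z)
        have 1: "?T z \<in> X \<times> Y \<longleftrightarrow> z \<in> ?X \<times> ?Y"
          unfolding vX[symmetric] vY[symmetric] by (cases z) simp
        have 2: "?T z \<in> B i \<times> B j \<longleftrightarrow> z \<in> B i \<times> B j" using elim(2) ij by simp
        show ?case
        proof (cases "z \<in> unit_square")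
          case True
          then have "r (?T z) = r z" "g (?T z) = relabel \<sigma> g z"
            using elim(1) relabel_eq_map_prod[OF True] by simp_all
          then show ?thesis
            unfolding F_def F'_def indicator_def 1 2 map_prod_extend_id_unit by simp
        next
          case False
          then show ?thesis
            unfolding F_def F'_def indicator_def 1 2 map_prod_extend_id_unit by simp
        qed
      qed
    qed
    also have "\<dots> = (LINT z:?X \<times> ?Y|lebesgue. ?I z * (r z - relabel \<sigma> g z))"
      unfolding set_lebesgue_integral_def F'_def
      using B_Times_subset[OF ij] by (intro Bochner_Integration.integral_cong) (auto simp: indicator_def)
    finally show ?thesis by simp
  qed
  then show ?thesis by (simp add: block_gap_def)
qed

lemma vimage_lebesgue_on_unit:
  assumes "X \<in> sets lebesgue" "X \<subseteq> {0..1}"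
  shows "\<sigma> -` X \<inter> {0..1} \<in> sets (lebesgue_on {0..1})"
proof -
  have "\<sigma> -` X \<inter> {0..1} \<in> sets lebesgue"
    using measurable_sets[OF extend_id_lebesgue(1) assms(1)] extend_id_vimage[OF assms(2)] by simp
  then show ?thesis by (subst sets_restrict_space_iff) auto
qed

end

section \<open>Distance zero from a block kernel\<close>

lemma block_ae_cong:
  assumes "block_ae C g" "AE z in lebesgue. z \<in> unit_square \<longrightarrow> g z = g' z"
  shows "block_ae C g'"
  using assms unfolding block_ae_def by eventually_elim auto

text \<open>For every \<sigma>, the preimages of \<open>X\<close> and \<open>Y\<close> are test sets
  whose gap equals the gap of \<open>r\<close> and \<open>g\<close> at \<open>X\<close> and
  \<open>Y\<close>. That number does not depend on \<sigma>, so it lies below the infimum, which is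
  0.\<close>

lemma cut_metric_0_block_left:
  assumes r: "r \<in> graphons" "block_ae C r" and g: "g \<in> graphons" and 0: "colored_cut_metric k B r g = 0"
  shows "block_ae C g"
proof (rule block_ae_cong[OF r(2)], rule block_gap_0_imp_AE_eq[OF r(1) g])
  fix X Y :: "real set" assume XY: "X \<in> sets borel" "Y \<in> sets borel" "X \<subseteq> {0..1}" "Y \<subseteq> {0..1}"
  then have leb: "X \<in> sets lebesgue" "Y \<in> sets lebesgue" by auto
  have "block_gap r g X Y \<le> colored_cut_metric k B r g"
  proof (rule block_gap_le_cut_metric[OF r(1) g])
    fix \<sigma> assume \<sigma>: "\<sigma> \<in> color_preserving_maps k B"
    show "\<exists>X'\<in>sets (lebesgue_on {0..1}). \<exists>Y'\<in>sets (lebesgue_on {0..1}).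
        block_gap r g X Y \<le> block_gap r (relabel \<sigma> g) X' Y'"
      using block_gap_vimage[OF \<sigma> r g leb XY(3,4)] vimage_lebesgue_on_unit[OF \<sigma> leb(1) XY(3)]
        vimage_lebesgue_on_unit[OF \<sigma> leb(2) XY(4)] order_refl by metis
  qed
  then show "block_gap r g X Y = 0"
    using block_gap_nonneg[of r g X Y] 0 by linarith
qed

text \<open>Here the relabelling acts on the block kernel, which it leaves unchanged almost
  everywhere, so the same test sets serve every \<sigma>. This direction leads from a representative
  back to the generator of its class; the other one describes the members of the class.\<close>

lemma cut_metric_0_block_right:
  assumes g: "g \<in> graphons" and r: "r \<in> graphons" "block_ae C r" and 0: "colored_cut_metric k B g r = 0"
  shows "block_ae C g"
proof -
  have "AE z in lebesgue. z \<in> unit_square \<longrightarrow> g z = r z"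
  proof (rule block_gap_0_imp_AE_eq[OF g r(1)])
    fix X Y :: "real set" assume XY: "X \<in> sets borel" "Y \<in> sets borel" "X \<subseteq> {0..1}" "Y \<subseteq> {0..1}"
    then have leb: "X \<in> sets lebesgue" "Y \<in> sets lebesgue" by auto
    have on: "X \<in> sets (lebesgue_on {0..1})" "Y \<in> sets (lebesgue_on {0..1})"
      using leb XY by (auto simp: sets_restrict_space_iff)
    have "block_gap g r X Y \<le> colored_cut_metric k B g r"
    proof (rule block_gap_le_cut_metric[OF g r(1)])
      fix \<sigma> assume \<sigma>: "\<sigma> \<in> color_preserving_maps k B"
      show "\<exists>X'\<in>sets (lebesgue_on {0..1}). \<exists>Y'\<in>sets (lebesgue_on {0..1}).
          block_gap g r X Y \<le> block_gap g (relabel \<sigma> r) X' Y'"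
        using block_gap_relabel_block[OF \<sigma> g r leb] on order_refl by metis
    qed
    then show "block_gap g r X Y = 0"
      using block_gap_nonneg[of g r X Y] 0 by linarith
  qed
  then have "AE z in lebesgue. z \<in> unit_square \<longrightarrow> r z = g z" by eventually_elim auto
  then show ?thesis using block_ae_cong[OF r(2)] by blast
qed

section \<open>Classes of the quotient and the maximizer\<close>

definition block_class :: "(nat \<Rightarrow> nat \<Rightarrow> real) \<Rightarrow> colored_kernel set" where
  "block_class C = {u \<in> colored_graphons B. block_ae C (fst u)}"

lemma quotient_class_of_block:
  assumes "u \<in> colored_graphons B" "block_ae C (fst u)"
  shows "cut_equiv k B `` {u} = block_class C"
proof (intro set_eqI iffI)
  fix v assume "v \<in> cut_equiv k B `` {u}"
  then show "v \<in> block_class C"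
    using cut_metric_0_block_left[of "fst u" C "fst v"] assms
    by (auto simp: cut_equiv_def block_class_def colored_graphons_def)
next
  fix v assume v: "v \<in> block_class C"
  have "AE z in lebesgue. z \<in> unit_square \<longrightarrow> fst u z = fst v z"
    using assms(2) v unfolding block_class_def block_ae_def by (auto elim: eventually_elim2)
  then have "colored_cut_metric k B (fst u) (fst v) = 0"
    using assms v by (intro cut_metric_eq_0) (auto simp: block_class_def colored_graphons_def)
  then show "v \<in> cut_equiv k B `` {u}"
    using assms v by (auto simp: cut_equiv_def block_class_def)
qed

text \<open>The kernel picked by Hilbert choice may differ from the generator \<open>u\<close>; what
  links them is distance 0, and this is recorded together with the choice.\<close>

lemma quotient_rep:
  assumes "X \<in> quotient_graphons k B"
  obtains u v where "u \<in> colored_graphons B" "X = cut_equiv k B `` {u}" "v \<in> X" "rep_kernel X = fst v"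
    "v \<in> colored_graphons B" "colored_cut_metric k B (fst u) (fst v) = 0"
proof -
  obtain u where u: "u \<in> colored_graphons B" "X = cut_equiv k B `` {u}"
    using assms by (auto simp: quotient_graphons_def elim: quotientE)
  have "colored_cut_metric k B (fst u) (fst u) = 0"
    using u by (intro cut_metric_eq_0) (auto simp: colored_graphons_def)
  then have "u \<in> X" using u by (auto simp: cut_equiv_def)
  then have v: "(SOME v. v \<in> X) \<in> X" by (rule someI)
  show ?thesis
    by (rule that[OF u v]) (use v u in \<open>auto simp: rep_kernel_def cut_equiv_def\<close>)
qed

text \<open>The coefficient \<open>1 - A / 2\<close> is strictly positive, so reaching
  \<open>block_value C\<close> forces the deficit to vanish. Existence and uniqueness of the
  maximizer follow at once.\<close>

lemma is_maximizer_iff: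
  assumes C: "solves_system k b \<alpha> h C"
  shows "is_maximizer k B \<alpha> h X \<longleftrightarrow> X = block_class C"
proof -
  have obj: "energy_functional k B \<alpha> h Y - 1/2 * entropy_functional k B Y = objective (rep_kernel Y)" for Y
    by (simp add: energy_functional_def entropy_functional_def objective_def)
  have max_iff: "is_maximizer k B \<alpha> h Y \<longleftrightarrow> Y \<in> quotient_graphons k B \<and>
      (\<forall>Z\<in>quotient_graphons k B. objective (rep_kernel Z) \<le> objective (rep_kernel Y))" for Y
    unfolding is_maximizer_def obj is_arg_max_def by (auto simp: not_less)
  have less: "0 < 1 - A / 2" using A_less by simp
  \<comment> \<open>The bound holds for every graphon, hence for whichever representative the choice
    selects.\<close>
  have le: "objective (rep_kernel Z) \<le> block_value C - (1 - A / 2) * deficit C (rep_kernel Z)"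
    if "Z \<in> quotient_graphons k B" for Z
    using quotient_rep[OF that] objective_le[OF _ C] by (metis colored_graphons_def mem_Times_iff)
  have block: "(block_kernel k B C, B) \<in> colored_graphons B"
    using block_kernel_graphon[OF C] by (simp add: colored_graphons_def)
  have "block_ae C (block_kernel k B C)" by (simp add: block_ae_def)
  then have class_eq: "block_class C = cut_equiv k B `` {(block_kernel k B C, B)}"
    using quotient_class_of_block[OF block] by simp
  then have class_q: "block_class C \<in> quotient_graphons k B"
    using block by (auto simp: quotient_graphons_def intro: quotientI)
  obtain v where "v \<in> block_class C" "rep_kernel (block_class C) = fst v"
    using quotient_rep[OF class_q] by metis
  then have class_val: "objective (rep_kernel (block_class C)) = block_value C"
    using objective_block[OF C] by (simp add: block_class_def)
  have bound: "objective (rep_kernel Z) \<le> block_value C" if "Z \<in> quotient_graphons k B" for Z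
    using le[OF that] mult_nonneg_nonneg[of "1 - A / 2" "deficit C (rep_kernel Z)"] less deficit_nonneg[of C "rep_kernel Z"]
    by linarith
  show ?thesis
  proof
    assume "X = block_class C"
    then show "is_maximizer k B \<alpha> h X"
      using class_q class_val bound by (simp add: max_iff)
  next
    assume "is_maximizer k B \<alpha> h X"
    then have X: "X \<in> quotient_graphons k B" and "block_value C \<le> objective (rep_kernel X)"
      using class_q class_val max_iff by metis+
    then have "(1 - A / 2) * deficit C (rep_kernel X) \<le> 0"
      using le[OF X] by linarith
    then have 0: "deficit C (rep_kernel X) = 0"
      using less deficit_nonneg[of C "rep_kernel X"] by (simp add: mult_le_0_iff)
    obtain u v where uv: "u \<in> colored_graphons B" "X = cut_equiv k B `` {u}" "v \<in> X" "rep_kernel X = fst v"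
        "v \<in> colored_graphons B" "colored_cut_metric k B (fst u) (fst v) = 0"
      using quotient_rep[OF X] by metis
    have g: "fst u \<in> graphons" "fst v \<in> graphons" using uv by (auto simp: colored_graphons_def)
    have "block_ae C (fst v)" using deficit_eq_0_imp[OF g(2) C] 0 uv by simp
    \<comment> \<open>The conclusion about the chosen \<open>v\<close> is carried back to
      \<open>u\<close>, because \<open>X\<close> is given as the image of \<open>u\<close>.\<close>
    then have "block_ae C (fst u)" using cut_metric_0_block_right[OF g] uv by simp
    then show "X = block_class C" using quotient_class_of_block[OF uv(1)] uv(2) by simp
  qed
qed

end

theorem corollary2p18:
  fixes k :: nat and b :: "nat \<Rightarrow> real" and B :: "nat \<Rightarrow> real set"
    and \<alpha> :: "nat \<Rightarrow> nat \<Rightarrow> nat \<Rightarrow> real" and h :: "nat \<Rightarrow> nat \<Rightarrow> real"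
  assumes b_pos: "\<forall>i<k. 0 < b i" and b_sum: "(\<Sum>i<k. b i) = 1"
    and B: "color_partition k b B"
    and \<alpha>_sym: "\<forall>i<k. \<forall>j<k. \<forall>l<k. \<alpha> i j l = \<alpha> i l j \<and> \<alpha> i j l = \<alpha> j i l \<and>
      \<alpha> i j l = \<alpha> j l i \<and> \<alpha> i j l = \<alpha> l i j \<and> \<alpha> i j l = \<alpha> l j i"
    and h_sym: "\<forall>i<k. \<forall>j<k. h i j = h j i"
    and \<alpha>_norm: "0 \<le> max_norm3 k \<alpha>" "max_norm3 k \<alpha> < 2"
  shows "(\<exists>!X. is_maximizer k B \<alpha> h X) \<and> (\<exists>!C. solves_system k b \<alpha> h C) \<and>
    (\<forall>X C. is_maximizer k B \<alpha> h X \<and> solves_system k b \<alpha> h C \<longrightarrow>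
      (\<forall>(g, P)\<in>X. AE z in lebesgue_on ({0..1} \<times> {0..1}). g z = block_kernel k B C z))"
proof -
  \<comment> \<open>Finiteness of the set makes \<open>Max\<close> an upper bound for its
    elements.\<close>
  have fin: "finite {\<bar>\<alpha> i j l\<bar> | i j l. i < k \<and> j < k \<and> l < k}"
  proof (rule finite_subset)
    show "{\<bar>\<alpha> i j l\<bar> | i j l. i < k \<and> j < k \<and> l < k} \<subseteq>
        (\<lambda>(i, j, l). \<bar>\<alpha> i j l\<bar>) ` ({..<k} \<times> {..<k} \<times> {..<k})" by force
  qed simp
  interpret colored_system k b \<alpha> h "max_norm3 k \<alpha>" B
  proof
    show "\<bar>\<alpha> i j l\<bar> \<le> max_norm3 k \<alpha>" if "i < k" "j < k" "l < k" for i j l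
      unfolding max_norm3_def using that by (intro Max_ge[OF fin]) blast
  qed (use assms in blast)+
  obtain C where C: "solves_system k b \<alpha> h C" using solves_system_exists by blast
  have max: "is_maximizer k B \<alpha> h X \<longleftrightarrow> X = block_class C" for X
    by (rule is_maximizer_iff[OF C])
  have C_unique: "C' = C" if "solves_system k b \<alpha> h C'" for C'
    using solves_system_unique[OF that C] .
  have "AE z in lebesgue_on unit_square. fst u z = block_kernel k B C z" if "u \<in> block_class C" for u
    using that unfolding block_class_def block_ae_def AE_lebesgue_on_unit_square by blast
  then have "\<forall>(g, P)\<in>block_class C. AE z in lebesgue_on unit_square. g z = block_kernel k B C z"
    unfolding case_prod_unfold by blast
  then show ?thesis
    unfolding max using C C_unique by blast
qed

end
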